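(* Define the integers $a_n$ ($n\ge0$) by $\prod_{n=1}^{\infty}(1-w^n)=\sum_{n=0}^{\infty}a_n w^n$ for $|w|<1$, and for $1/4<s<1/2$ define, for functions $g$ on $\mathbb{Z}$, \[ \mathcal{I}_{s,f}\,g(m)=\sum_{n=1}^{\infty}\frac{a_n}{n^s}\,g(m-n),\qquad m\in\mathbb{Z}. \] If $1<p\le 2\le q<\infty$ and \[ \frac1q\le\frac1p-\frac12+s, \] then there is a constant $C$ such that $\|\mathcal{I}_{s,f}\,g\|_{\ell^q(\mathbb{Z})}\le C\|g\|_{\ell^p(\mathbb{Z})}$ for all $g\in\ell^p(\mathbb{Z})$.
   Context: $\ell^p(\mathbb{Z})$ is the space of functions $g$ on $\mathbb{Z}$ with $\|g\|_{\ell^p}=(\sum_{m\in\mathbb{Z}}|g(m)|^p)^{1/p}<\infty$. By Euler's pentagonal number theorem, $a_n\in\{0,\pm1\}$ and $a_n\neq 0$ only for $n=(3k^2+k)/2$, $k\in\mathbb{Z}$. *)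

theory Defs
  imports "HOL-Analysis.Analysis"
begin

definition euler_coeff :: "nat \<Rightarrow> int" where
  "euler_coeff = (THE a. \<forall>w::complex. norm w < 1 \<longrightarrow>
      (\<lambda>n. of_int (a n) * w ^ n) sums (\<Prod>k. (1 - w ^ Suc k)))"

definition in_lp :: "real \<Rightarrow> (int \<Rightarrow> complex) \<Rightarrow> bool" where
  "in_lp p g \<longleftrightarrow> (\<lambda>m. norm (g m) powr p) summable_on (UNIV :: int set)"

definition lp_norm :: "real \<Rightarrow> (int \<Rightarrow> complex) \<Rightarrow> real" where
  "lp_norm p g = (\<Sum>\<^sub>\<infinity>m\<in>(UNIV :: int set). norm (g m) powr p) powr (1 / p)"

definition I_sf :: "real \<Rightarrow> (int \<Rightarrow> complex) \<Rightarrow> int \<Rightarrow> complex" where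
  "I_sf s g m = (\<Sum>n. of_real (real_of_int (euler_coeff (Suc n)) / real (Suc n) powr s)
                       * g (m - int (Suc n)))"

end

theory Submission
  imports Defs "HOL-Complex_Analysis.Complex_Analysis"
begin

text \<open>
  Since \<open>p \<le> 2 \<le> q\<close>, the inclusions of \<open>\<ell>\<^sup>p\<close> in \<open>\<ell>\<^sup>2\<close> and of \<open>\<ell>\<^sup>2\<close> in \<open>\<ell>\<^sup>q\<close> reduce the claim to
  boundedness on \<open>\<ell>\<^sup>2\<close>, that is, to boundedness of the multiplier \<open>\<Sum>n\<ge>1. a\<^sub>n n\<^sup>-\<^sup>s w\<^sup>n\<close> on the unit circle.
  Writing \<open>\<Gamma>(s) n\<^sup>-\<^sup>s\<close> as the integral of \<open>y\<^sup>s\<^sup>-\<^sup>1 e\<^sup>-\<^sup>n\<^sup>y\<close> over \<open>y > 0\<close>, this follows for \<open>s > 1/4\<close> from the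
  bound \<open>O(y\<^sup>-\<^sup>1\<^sup>/\<^sup>4)\<close> for the Euler product on the circle of radius \<open>e\<^sup>-\<^sup>y\<close>, that is, from the fact that
  \<open>Im \<tau> * \<bar>\<eta> \<tau>\<bar>\<^sup>4\<close> is bounded on the upper half plane.

  That function is invariant under \<open>\<tau> \<mapsto> \<tau> + 1\<close> and \<open>\<tau> \<mapsto> -1/\<tau>\<close>. As long as \<open>Im \<tau> < 1/2\<close>, translating to
  \<open>\<bar>Re \<tau>\<bar> \<le> 1/2\<close> and then inverting at least doubles \<open>Im \<tau>\<close>, so only \<open>Im \<tau> \<ge> 1/2\<close> has to be considered,
  where the bound is trivial. Invariance under inversion comes from the theta product: the quotient of
  \<open>exp (- \<pi> i x\<^sup>2 / \<tau>) \<theta>(x/\<tau>; -1/\<tau>)\<close> and \<open>\<theta>(x; \<tau>)\<close> is an elliptic function without poles,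
  hence a constant. Its limit at \<open>x = 0\<close> contains the quotient of the two eta values, while its absolute
  value is found by multiplying its values at the three half periods, where the products cancel.
\<close>

subsection \<open>The q-Pochhammer symbol\<close>

text \<open>The infinite q-Pochhammer symbol. Its diagonal \<open>qprod w w\<close> is the Euler
  product; the theta product needs the first argument to be independent.\<close>

definition qprod :: "complex \<Rightarrow> complex \<Rightarrow> complex" where
  "qprod a q = (\<Prod>n. 1 - a * q ^ n)"

lemma convergent_prod_qprod:
  fixes a q :: complex
  assumes "norm q < 1"
  shows "convergent_prod (\<lambda>n. 1 - a * q ^ n)"
proof (rule abs_convergent_prod_imp_convergent_prod)
  have "summable (\<lambda>n. norm a * norm q ^ n)"
    using assms by (intro summable_mult summable_geometric) auto
  then show "abs_convergent_prod (\<lambda>n. 1 - a * q ^ n)"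
    by (simp add: abs_convergent_prod_conv_summable norm_mult norm_power)
qed

lemma has_prod_qprod: "norm q < 1 \<Longrightarrow> (\<lambda>n. 1 - a * q ^ n) has_prod qprod a q"
  using convergent_prod_qprod convergent_prod_has_prod unfolding qprod_def by blast

lemma LIMSEQ_qprod:
  assumes "norm q < 1"
  shows "(\<lambda>n. \<Prod>k<n. 1 - a * q ^ k) \<longlonglongrightarrow> qprod a q"
  using has_prod_imp_tendsto'[OF has_prod_qprod[OF assms]] .

lemma qprod_eq_0_iff: "norm q < 1 \<Longrightarrow> qprod a q = 0 \<longleftrightarrow> (\<exists>n. a * q ^ n = 1)"
  using has_prod_eq_0_iff[OF has_prod_qprod] by (fastforce simp: image_iff)

lemma qprod_rec:
  assumes "norm q < 1"
  shows "qprod a q = (1 - a) * qprod (a * q) q"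
proof (rule LIMSEQ_unique)
  show "(\<lambda>n. \<Prod>k<Suc n. 1 - a * q ^ k) \<longlonglongrightarrow> qprod a q"
    using LIMSEQ_qprod[OF assms] by (rule LIMSEQ_Suc)
  have "(\<Prod>k<Suc n. 1 - a * q ^ k) = (1 - a) * (\<Prod>k<n. 1 - a * q * q ^ k)" for n
    by (simp add: prod.lessThan_Suc_shift mult.assoc del: prod.lessThan_Suc)
  then show "(\<lambda>n. \<Prod>k<Suc n. 1 - a * q ^ k) \<longlonglongrightarrow> (1 - a) * qprod (a * q) q"
    using tendsto_mult[OF tendsto_const LIMSEQ_qprod[OF assms]] by simp
qed

lemma norm_qprod_le:
  assumes "norm q < 1"
  shows "norm (qprod a q) \<le> exp (norm a / (1 - norm q))"
proof (rule LIMSEQ_le_const2[OF tendsto_norm[OF LIMSEQ_qprod[OF assms]]])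
  have "norm (\<Prod>k<n. 1 - a * q ^ k) \<le> exp (norm a / (1 - norm q))" for n
  proof -
    have "norm (\<Prod>k<n. 1 - a * q ^ k) \<le> (\<Prod>k<n. 1 + norm a * norm q ^ k)"
      unfolding prod_norm[symmetric]
      by (intro prod_mono) (auto intro: order.trans[OF norm_triangle_ineq4] simp: norm_mult norm_power)
    also have "\<dots> \<le> exp (\<Sum>k<n. norm a * norm q ^ k)"
      by (rule prod_le_exp_sum) auto
    also have "(\<Sum>k<n. norm a * norm q ^ k) \<le> (\<Sum>k. norm a * norm q ^ k)"
      using assms by (intro sum_le_suminf summable_mult summable_geometric) auto
    also have "(\<Sum>k. norm a * norm q ^ k) = norm a / (1 - norm q)"
      using assms by (simp add: suminf_mult suminf_geometric)
    finally show ?thesis by simp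
  qed
  then show "\<exists>N. \<forall>n\<ge>N. norm (\<Prod>k<n. 1 - a * q ^ k) \<le> exp (norm a / (1 - norm q))"
    by blast
qed

text \<open>Weierstrass M-test: on the compact set \<open>f\<close> is bounded and the norm of
  \<open>g\<close> has a maximum below 1. Both arguments may vary, which covers theta as a function
  of \<open>x\<close> as well as the diagonal \<open>qprod w w\<close>.\<close>

lemma uniform_limit_qprod:
  fixes f g :: "complex \<Rightarrow> complex"
  assumes "compact K" "continuous_on K f" "continuous_on K g" "\<And>x. x \<in> K \<Longrightarrow> norm (g x) < 1"
  shows "uniform_limit K (\<lambda>n x. \<Prod>k<n. 1 - f x * g x ^ k) (\<lambda>x. qprod (f x) (g x)) sequentially"
proof (cases "K = {}")
  case False
  obtain M where M: "\<And>x. x \<in> K \<Longrightarrow> norm (f x) \<le> M"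
    using compact_imp_bounded[OF compact_continuous_image[OF assms(2,1)]]
    by (auto simp: bounded_iff)
  obtain x0 where x0: "x0 \<in> K" "\<And>x. x \<in> K \<Longrightarrow> norm (g x) \<le> norm (g x0)"
    using continuous_attains_sup[OF assms(1) False continuous_on_norm[OF assms(3)]] by blast
  have "uniformly_convergent_on K (\<lambda>N x. \<Sum>n<N. norm (f x * g x ^ n))"
  proof (rule Weierstrass_m_test'_ev[OF always_eventually])
    show "\<forall>n. \<forall>x\<in>K. norm (norm (f x * g x ^ n)) \<le> M * norm (g x0) ^ n"
      using M x0 order_trans[OF norm_ge_zero M[OF x0(1)]]
      by (auto simp: norm_mult norm_power intro!: mult_mono power_mono)
    show "summable (\<lambda>n. M * norm (g x0) ^ n)"
      using assms(4)[OF x0(1)] by (intro summable_mult summable_geometric) auto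
  qed
  then have "uniformly_convergent_on K (\<lambda>n x. \<Prod>k<n. 1 - f x * g x ^ k)"
    by (intro uniformly_convergent_on_prod') (auto intro!: continuous_intros assms)
  then obtain l where l: "uniform_limit K (\<lambda>n x. \<Prod>k<n. 1 - f x * g x ^ k) l sequentially"
    by (auto simp: uniformly_convergent_on_def)
  have "l x = qprod (f x) (g x)" if "x \<in> K" for x
    using LIMSEQ_unique[OF tendsto_uniform_limitI[OF l that] LIMSEQ_qprod] assms(4)[OF that] by blast
  with l show ?thesis
    by (metis (mono_tags, lifting) uniform_limit_cong')
qed auto

lemma holomorphic_on_qprod:
  assumes "open S" "f holomorphic_on S" "g holomorphic_on S" "\<And>x. x \<in> S \<Longrightarrow> norm (g x) < 1"
  shows "(\<lambda>x. qprod (f x) (g x)) holomorphic_on S"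
proof (rule holomorphic_uniform_sequence[OF assms(1)])
  show "(\<lambda>x. \<Prod>k<n. 1 - f x * g x ^ k) holomorphic_on S" for n
    by (intro holomorphic_intros assms)
  fix x assume "x \<in> S"
  then obtain d where d: "d > 0" "cball x d \<subseteq> S"
    using assms(1) open_contains_cball by blast
  then have "uniform_limit (cball x d) (\<lambda>n x. \<Prod>k<n. 1 - f x * g x ^ k) (\<lambda>x. qprod (f x) (g x)) sequentially"
    by (intro uniform_limit_qprod)
      (auto intro!: assms(4) holomorphic_on_imp_continuous_on holomorphic_on_subset[OF assms(2)]
        holomorphic_on_subset[OF assms(3)])
  with d show "\<exists>d>0. cball x d \<subseteq> S \<and>
      uniform_limit (cball x d) (\<lambda>n x. \<Prod>k<n. 1 - f x * g x ^ k) (\<lambda>x. qprod (f x) (g x)) sequentially"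
    by blast
qed

lemma norm_power_less_one: "norm (q :: complex) < 1 \<Longrightarrow> 0 < n \<Longrightarrow> norm (q ^ n) < 1"
  by (simp add: norm_power power_less_one_iff)

lemma qprod_nonzero:
  assumes "norm q < 1" "norm a < 1"
  shows "qprod a q \<noteq> 0"
proof
  assume "qprod a q = 0"
  then obtain n where n: "a * q ^ n = 1"
    using assms by (auto simp: qprod_eq_0_iff)
  have "norm (a * q ^ n) \<le> norm a * 1"
    unfolding norm_mult norm_power using assms by (intro mult_left_mono power_le_one) auto
  with n assms show False by simp
qed

text \<open>Factors of equal index combine to a difference of squares.\<close>

lemma qprod_mult_qprod_uminus:
  assumes "norm q < 1"
  shows "qprod a q * qprod (- a) q = qprod (a\<^sup>2) (q\<^sup>2)"
proof (rule LIMSEQ_unique)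
  have "(\<Prod>k<n. 1 - a * q ^ k) * (\<Prod>k<n. 1 - (- a) * q ^ k) = (\<Prod>k<n. 1 - a\<^sup>2 * (q\<^sup>2) ^ k)" for n
    unfolding prod.distrib[symmetric]
    by (intro prod.cong) (auto simp: algebra_simps power2_eq_square power_mult_distrib)
  then show "(\<lambda>n. \<Prod>k<n. 1 - a\<^sup>2 * (q\<^sup>2) ^ k) \<longlonglongrightarrow> qprod a q * qprod (- a) q"
    using tendsto_mult[OF LIMSEQ_qprod[OF assms] LIMSEQ_qprod[OF assms], of a "- a"] by simp
  show "(\<lambda>n. \<Prod>k<n. 1 - a\<^sup>2 * (q\<^sup>2) ^ k) \<longlonglongrightarrow> qprod (a\<^sup>2) (q\<^sup>2)"
    using assms by (intro LIMSEQ_qprod norm_power_less_one) auto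
qed

lemma qprod_even_odd:
  assumes "norm q < 1"
  shows "qprod a q = qprod a (q\<^sup>2) * qprod (a * q) (q\<^sup>2)"
proof (rule LIMSEQ_unique)
  have *: "(\<Prod>k<2 * n. 1 - a * q ^ k)
    = (\<Prod>k<n. 1 - a * (q\<^sup>2) ^ k) * (\<Prod>k<n. 1 - a * q * (q\<^sup>2) ^ k)" for n
    by (induction n) (simp_all add: algebra_simps power_mult[symmetric])
  show "(\<lambda>n. \<Prod>k<2 * n. 1 - a * q ^ k) \<longlonglongrightarrow> qprod a q"
    using LIMSEQ_subseq_LIMSEQ[OF LIMSEQ_qprod[OF assms], of "\<lambda>n. 2 * n"]
    by (simp add: strict_mono_def o_def)
  show "(\<lambda>n. \<Prod>k<2 * n. 1 - a * q ^ k) \<longlonglongrightarrow> qprod a (q\<^sup>2) * qprod (a * q) (q\<^sup>2)"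
    unfolding * using assms by (intro tendsto_mult LIMSEQ_qprod norm_power_less_one) auto
qed

text \<open>With \<open>h = ee (\<tau> / 2)\<close> these are the products occurring in theta at the
  three half periods. The last two combine to \<open>qprod q (q\<^sup>2)\<close>; multiplying by
  \<open>qprod (q\<^sup>2) (q\<^sup>2)\<close> completes this to \<open>qprod q q\<close>, and the
  factor \<open>qprod (- q) q\<close> then gives back the nonzero
  \<open>qprod (q\<^sup>2) (q\<^sup>2)\<close>, which cancels.\<close>

lemma qprod_half_periods:
  assumes "norm h < 1" "q = h\<^sup>2"
  shows "qprod (- q) q * qprod h q * qprod (- h) q = 1"
proof -
  have q: "norm q < 1" "norm (q\<^sup>2) < 1"
    using assms by (auto intro!: norm_power_less_one)
  have "qprod (- q) q * (qprod h q * qprod (- h) q) * qprod (q\<^sup>2) (q\<^sup>2)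
      = qprod (- q) q * (qprod q (q\<^sup>2) * qprod (q * q) (q\<^sup>2))"
    using qprod_mult_qprod_uminus[OF q(1), of h] assms(2) by (simp add: power2_eq_square)
  also have "\<dots> = qprod q q * qprod (- q) q"
    using qprod_even_odd[OF q(1), of q] by simp
  also have "\<dots> = qprod (q\<^sup>2) (q\<^sup>2)"
    by (rule qprod_mult_qprod_uminus[OF q(1)])
  finally show ?thesis
    using qprod_nonzero[OF q(2) q(2)] by (simp add: mult.assoc)
qed

subsection \<open>The theta product and its inversion formula\<close>

definition ee :: "complex \<Rightarrow> complex" where
  "ee z = exp (2 * of_real pi * \<i> * z)"

lemma ee_add: "ee (a + b) = ee a * ee b"
  by (simp add: ee_def exp_add ring_distribs)

lemma ee_diff: "ee (a - b) = ee a / ee b"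
  by (simp add: ee_def exp_diff ring_distribs)

lemma ee_minus: "ee (- a) = inverse (ee a)"
  by (simp add: ee_def exp_minus)

lemma cnj_ee: "cnj (ee z) = ee (- cnj z)"
  by (simp add: ee_def exp_cnj)

lemma ee_nonzero [simp]: "ee a \<noteq> 0"
  by (simp add: ee_def)

lemma ee_0 [simp]: "ee 0 = 1"
  by (simp add: ee_def)

lemma ee_of_nat_mult: "ee (of_nat n * a) = ee a ^ n"
  unfolding ee_def by (subst exp_of_nat_mult[symmetric]) (simp add: algebra_simps)

lemma ee_eq_1_iff: "ee z = 1 \<longleftrightarrow> (\<exists>n::int. z = of_int n)"
proof -
  have "ee z = 1 \<longleftrightarrow> Im z = 0 \<and> (\<exists>n::int. Re z = of_int n)"
    by (auto simp: ee_def exp_eq_1)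
  then show ?thesis
    by (auto simp: complex_eq_iff)
qed

lemma ee_1 [simp]: "ee 1 = 1"
  using ee_eq_1_iff[of 1] by (metis of_int_1)

lemma ee_half [simp]: "ee (1 / 2) = - 1"
  by (simp add: ee_def)

lemma norm_ee: "norm (ee z) = exp (- 2 * pi * Im z)"
  by (simp add: ee_def)

lemma norm_ee_less_1 [simp]: "Im z > 0 \<Longrightarrow> norm (ee z) < 1"
  by (simp add: norm_ee)

lemma holomorphic_on_ee [holomorphic_intros]:
  "f holomorphic_on A \<Longrightarrow> (\<lambda>x. ee (f x)) holomorphic_on A"
  unfolding ee_def by (intro holomorphic_intros)

text \<open>Up to a factor depending on \<open>\<tau>\<close> only, this is the Jacobi theta function \<open>\<theta>\<^sub>1\<close>.\<close>

definition jtheta :: "complex \<Rightarrow> complex \<Rightarrow> complex" where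
  "jtheta x \<tau> = ee (- x / 2) * qprod (ee x) (ee \<tau>) * qprod (ee (\<tau> - x)) (ee \<tau>)"

lemma jtheta_plus_1: "jtheta (x + 1) \<tau> = - jtheta x \<tau>"
proof -
  have "ee (- (x + 1) / 2) = - ee (- x / 2)"
    using ee_diff[of "- x / 2" "1 / 2"] by (simp add: diff_divide_distrib)
  moreover have "ee (\<tau> - (x + 1)) = ee (\<tau> - x)"
    using ee_diff[of "\<tau> - x" 1] by (simp add: algebra_simps)
  ultimately show ?thesis
    by (simp add: jtheta_def ee_add)
qed

text \<open>Splits off the factor responsible for the zero at \<open>x = 0\<close>.\<close>

lemma jtheta_factor:
  assumes "Im \<tau> > 0"
  shows "jtheta x \<tau> = (1 - ee x) * (ee (- x / 2) * qprod (ee (\<tau> + x)) (ee \<tau>) * qprod (ee (\<tau> - x)) (ee \<tau>))"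
  using qprod_rec[of "ee \<tau>" "ee x"] assms by (simp add: jtheta_def ee_add mult_ac)

text \<open>The shift moves one factor between the two products: \<open>1 - ee x\<close> leaves the
  first, and \<open>1 - ee (- x) = - ee (- x) * (1 - ee x)\<close> enters the second.\<close>

lemma jtheta_plus_tau:
  assumes "Im \<tau> > 0"
  shows "jtheta (x + \<tau>) \<tau> = - ee (- \<tau> / 2 - x) * jtheta x \<tau>"
proof -
  have 1: "qprod (ee (- x)) (ee \<tau>) = (1 - ee (- x)) * qprod (ee (\<tau> - x)) (ee \<tau>)"
    using qprod_rec[of "ee \<tau>" "ee (- x)"] assms by (simp add: ee_diff ee_minus field_simps)
  have 2: "ee (- (x + \<tau>) / 2) = ee (- \<tau> / 2) * ee (- x / 2)"
    by (subst ee_add[symmetric]) (simp add: field_simps)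
  have 3: "(1 - ee (- x)) = - ee (- x) * (1 - ee x)"
    by (simp add: ee_minus field_simps)
  have "jtheta (x + \<tau>) \<tau> = ee (- (x + \<tau>) / 2) * qprod (ee (\<tau> + x)) (ee \<tau>) * qprod (ee (- x)) (ee \<tau>)"
    by (simp add: jtheta_def add.commute)
  also have "\<dots> = - (ee (- \<tau> / 2) * ee (- x)) * jtheta x \<tau>"
    unfolding jtheta_factor[OF assms] 1 2 3 by (simp add: mult_ac)
  also have "ee (- \<tau> / 2) * ee (- x) = ee (- \<tau> / 2 - x)"
    by (simp add: ee_add[symmetric])
  finally show ?thesis .
qed

text \<open>Confines the possible singularities of the quotient in the inversion formula to the
  period lattice.\<close>

lemma jtheta_eq_0D:
  assumes "Im \<tau> > 0" "jtheta x \<tau> = 0"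
  obtains m n :: int where "x = of_int m + of_int n * \<tau>"
proof -
  have "(\<exists>n. ee x * ee \<tau> ^ n = 1) \<or> (\<exists>n. ee (\<tau> - x) * ee \<tau> ^ n = 1)"
    using assms by (auto simp: jtheta_def qprod_eq_0_iff)
  then have "(\<exists>n::nat. ee (x + of_nat n * \<tau>) = 1) \<or> (\<exists>n::nat. ee (\<tau> - x + of_nat n * \<tau>) = 1)"
    by (simp add: ee_add ee_of_nat_mult)
  then consider n :: nat and k :: int where "x + of_nat n * \<tau> = of_int k"
    | n :: nat and k :: int where "\<tau> - x + of_nat n * \<tau> = of_int k"
    by (auto simp: ee_eq_1_iff)
  then show ?thesis
  proof cases
    case 1
    then show ?thesis
      by (intro that[of k "- int n"]) (simp add: algebra_simps)
  next
    case 2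
    then have "x = of_int (- k) + of_int (int n + 1) * \<tau>"
      by (simp add: algebra_simps)
    then show ?thesis
      by (rule that)
  qed
qed

lemma jtheta_0 [simp]: "Im \<tau> > 0 \<Longrightarrow> jtheta 0 \<tau> = 0"
  by (simp add: jtheta_factor)

lemma jtheta_holomorphic [holomorphic_intros]:
  assumes "Im \<tau> > 0" "f holomorphic_on A" "open A"
  shows "(\<lambda>x. jtheta (f x) \<tau>) holomorphic_on A"
  unfolding jtheta_def using assms by (intro holomorphic_intros holomorphic_on_qprod) auto

text \<open>This is the derivative of theta at its zero 0, the place where the Euler product at
  \<open>ee \<tau>\<close> appears: it is the derivative of \<open>1 - ee x\<close> times the
  cofactor in \<open>jtheta_factor\<close> at 0.\<close>

lemma jtheta_over_id_tendsto:
  assumes "Im \<tau> > 0"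
  shows "((\<lambda>x. jtheta x \<tau> / x) \<longlongrightarrow> - 2 * of_real pi * \<i> * qprod (ee \<tau>) (ee \<tau>) ^ 2) (at 0)"
proof -
  define U where "U = (\<lambda>x. ee (- x / 2) * qprod (ee (\<tau> + x)) (ee \<tau>) * qprod (ee (\<tau> - x)) (ee \<tau>))"
  have "U holomorphic_on UNIV"
    unfolding U_def using assms by (intro holomorphic_intros holomorphic_on_qprod) auto
  then have "isCont U 0"
    using holomorphic_on_imp_continuous_on continuous_on_eq_continuous_at open_UNIV by blast
  then have U: "(U \<longlongrightarrow> U 0) (at 0)"
    by (simp add: isCont_def)
  have "((\<lambda>x. 1 - ee x) has_field_derivative (- 2 * of_real pi * \<i>)) (at 0)"
    unfolding ee_def by (auto intro!: derivative_eq_intros)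
  then have "((\<lambda>x. (1 - ee x) / x) \<longlongrightarrow> - 2 * of_real pi * \<i>) (at 0)"
    by (simp add: has_field_derivative_iff)
  from tendsto_mult[OF this U] show ?thesis
    using assms by (simp add: jtheta_factor U_def power2_eq_square mult_ac)
qed

lemma jtheta_nonzero_near_0:
  assumes "Im \<tau> > 0"
  shows "eventually (\<lambda>x. jtheta x \<tau> \<noteq> 0) (at 0)"
proof -
  have "- 2 * of_real pi * \<i> * qprod (ee \<tau>) (ee \<tau>) ^ 2 \<noteq> 0"
    using assms by (simp add: qprod_nonzero)
  from tendsto_imp_eventually_ne[OF jtheta_over_id_tendsto[OF assms] this] show ?thesis
    by (rule eventually_mono) auto
qed

section \<open>Elliptic functions and the inversion formula\<close>

lemma period_of_int:
  fixes f :: "complex \<Rightarrow> complex"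
  assumes "\<And>x. f (x + \<omega>) = f x"
  shows "f (x + of_int n * \<omega>) = f x"
proof (induction n rule: int_induct[where k = 0])
  case (step1 i)
  then show ?case using assms[of "x + of_int i * \<omega>"] by (simp add: algebra_simps)
next
  case (step2 i)
  then show ?case using assms[of "x + of_int (i - 1) * \<omega>"] by (simp add: algebra_simps)
qed auto

text \<open>Translation by periods brings every point into the closed parallelogram spanned by 1 and
  \<tau>, so the range is contained in the image of a compact set and Liouville's theorem
  applies.\<close>

lemma elliptic_entire_constant:
  fixes f :: "complex \<Rightarrow> complex"
  assumes hol: "f holomorphic_on UNIV" and \<tau>: "Im \<tau> > 0"
    and per: "\<And>x. f (x + 1) = f x" "\<And>x. f (x + \<tau>) = f x"
  shows "f constant_on UNIV"
proof (rule Liouville_theorem[OF hol])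
  have lat: "f (x + of_int m + of_int n * \<tau>) = f x" for x and m n :: int
    using period_of_int[of f 1, OF per(1)] period_of_int[of f \<tau>, OF per(2)] by simp
  define P where "P = (\<lambda>(u, v). complex_of_real u + of_real v * \<tau>) ` cbox (0, 0) (1, 1)"
  have "compact P"
    unfolding P_def case_prod_unfold by (intro compact_continuous_image continuous_intros compact_cbox)
  have "range f \<subseteq> f ` P"
  proof safe
    fix x :: complex
    define v where "v = Im x / Im \<tau>"
    define u where "u = Re x - v * Re \<tau>"
    have x: "x = of_real u + of_real v * \<tau>"
      using \<tau> by (simp add: complex_eq_iff u_def v_def)
    have "f x = f (of_real (frac u) + of_real (frac v) * \<tau>)"
      using lat[of "of_real (frac u) + of_real (frac v) * \<tau>" "\<lfloor>u\<rfloor>" "\<lfloor>v\<rfloor>"]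
      by (simp add: x frac_def algebra_simps)
    moreover have "of_real (frac u) + of_real (frac v) * \<tau> \<in> P"
      unfolding P_def by (rule image_eqI[of _ _ "(frac u, frac v)"])
        (auto simp: cbox_Pair_eq less_imp_le[OF frac_lt_1])
    ultimately show "f x \<in> f ` P"
      by blast
  qed
  moreover have "compact (f ` P)"
    using \<open>compact P\<close> hol
    by (intro compact_continuous_image holomorphic_on_imp_continuous_on) (auto intro: holomorphic_on_subset)
  ultimately show "bounded (range f)"
    by (meson bounded_subset compact_imp_bounded)
qed

lemma Im_minus_inverse_pos: "Im \<tau> > 0 \<Longrightarrow> Im (- 1 / \<tau>) > 0"
  by (simp add: Im_divide field_simps sum_power2_gt_zero_iff)

text \<open>With \<open>t = - 1 / \<tau>\<close> one has
  \<open>x / \<tau> = (x + 1) / \<tau> + t\<close>, so the quasi-period \<open>t\<close> applies and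
  the Gaussian factor absorbs its multiplier. The sign left over is that of
  \<open>jtheta_plus_1\<close>.\<close>

lemma jtheta_ratio_plus_1:
  assumes \<tau>: "Im \<tau> > 0"
  shows "ee (- ((x + 1)\<^sup>2) / (2 * \<tau>)) * jtheta ((x + 1) / \<tau>) (- 1 / \<tau>)
    = - (ee (- (x\<^sup>2) / (2 * \<tau>)) * jtheta (x / \<tau>) (- 1 / \<tau>))"
proof -
  have [simp]: "\<tau> \<noteq> 0" using \<tau> by auto
  define t where "t = - 1 / \<tau>"
  have t: "Im t > 0"
    unfolding t_def by (rule Im_minus_inverse_pos[OF \<tau>])
  have "jtheta (x / \<tau>) t = - ee (- t / 2 - (x + 1) / \<tau>) * jtheta ((x + 1) / \<tau>) t"
    using jtheta_plus_tau[OF t, of "(x + 1) / \<tau>"] by (simp add: t_def diff_divide_distrib add_divide_distrib)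
  moreover have "ee (- (x\<^sup>2) / (2 * \<tau>)) * ee (- t / 2 - (x + 1) / \<tau>) = ee (- ((x + 1)\<^sup>2) / (2 * \<tau>))"
    unfolding ee_add[symmetric] by (rule arg_cong[of _ _ ee]) (simp add: t_def field_simps power2_eq_square)
  ultimately show ?thesis
    unfolding t_def[symmetric] by (simp flip: mult.assoc)
qed

text \<open>Here \<open>x / \<tau>\<close> moves by 1, which only changes the sign, and the Gaussian
  factor supplies exactly the multiplier of \<open>jtheta_plus_tau\<close>.\<close>

lemma jtheta_ratio_plus_tau:
  assumes \<tau>: "Im \<tau> > 0"
  shows "ee (- ((x + \<tau>)\<^sup>2) / (2 * \<tau>)) * jtheta ((x + \<tau>) / \<tau>) (- 1 / \<tau>)
    = - ee (- \<tau> / 2 - x) * (ee (- (x\<^sup>2) / (2 * \<tau>)) * jtheta (x / \<tau>) (- 1 / \<tau>))"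
proof -
  have [simp]: "\<tau> \<noteq> 0" using \<tau> by auto
  have "ee (- \<tau> / 2 - x) * ee (- (x\<^sup>2) / (2 * \<tau>)) = ee (- ((x + \<tau>)\<^sup>2) / (2 * \<tau>))"
    unfolding ee_add[symmetric] by (rule arg_cong[of _ _ ee]) (simp add: field_simps power2_eq_square)
  then show ?thesis
    using jtheta_plus_1[of "x / \<tau>" "- 1 / \<tau>"] by (simp add: add_divide_distrib flip: mult.assoc)
qed

text \<open>The constant \<open>c\<close> is the limit at 0 of the elliptic quotient
  \<open>R\<close>, that is, the ratio of the derivatives of its numerator and denominator
  there.\<close>

lemma jtheta_inversion:
  assumes \<tau>: "Im \<tau> > 0" and x: "jtheta x \<tau> \<noteq> 0"
  defines "c \<equiv> qprod (ee (- 1 / \<tau>)) (ee (- 1 / \<tau>)) ^ 2 / (\<tau> * qprod (ee \<tau>) (ee \<tau>) ^ 2)"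
  shows "jtheta (x / \<tau>) (- 1 / \<tau>) = c * ee (x\<^sup>2 / (2 * \<tau>)) * jtheta x \<tau>"
proof -
  have [simp]: "\<tau> \<noteq> 0" using \<tau> by auto
  define t where "t = - 1 / \<tau>"
  have t: "Im t > 0"
    unfolding t_def by (rule Im_minus_inverse_pos[OF \<tau>])
  define N where "N = (\<lambda>x. ee (- (x\<^sup>2) / (2 * \<tau>)) * jtheta (x / \<tau>) t)"
  define R where "R = (\<lambda>x. N x / jtheta x \<tau>)"
  \<comment> \<open>\<open>F\<close> takes the value \<open>c\<close> at the zeros of theta in order
    to remove the singularities of \<open>R\<close>.\<close>
  define F where "F = (\<lambda>x. if jtheta x \<tau> = 0 then c else R x)"
  have N_hol: "N holomorphic_on UNIV"
    unfolding N_def using t by (intro holomorphic_intros) auto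
  have R_per: "R (x + 1) = R x" "R (x + \<tau>) = R x" for x
    using jtheta_ratio_plus_1[OF \<tau>, of x] jtheta_ratio_plus_tau[OF \<tau>, of x]
    by (simp_all add: R_def N_def t_def jtheta_plus_1 jtheta_plus_tau[OF \<tau>])
  have F_per: "F (x + 1) = F x" "F (x + \<tau>) = F x" for x
    by (simp_all add: F_def R_per) (simp_all add: jtheta_plus_1 jtheta_plus_tau[OF \<tau>])
  have R_hol: "R holomorphic_on A" if "open A" "\<And>x. x \<in> A \<Longrightarrow> jtheta x \<tau> \<noteq> 0" for A
    unfolding R_def using that \<tau> by (intro holomorphic_intros holomorphic_on_subset[OF N_hol]) auto
  have lim: "(R \<longlongrightarrow> c) (at 0)"
  proof -
    have "filterlim (\<lambda>x. x / \<tau>) (at 0) (at 0)"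
      by (rule filterlim_atI) (auto intro!: tendsto_eq_intros simp: eventually_at_filter)
    from filterlim_compose[OF jtheta_over_id_tendsto[OF t] this]
    have 1: "((\<lambda>x. jtheta (x / \<tau>) t / (x / \<tau>)) \<longlongrightarrow> - 2 * of_real pi * \<i> * qprod (ee t) (ee t) ^ 2) (at 0)" .
    have "isCont (\<lambda>x. ee (- (x\<^sup>2) / (2 * \<tau>))) 0"
      unfolding ee_def by (intro continuous_intros) auto
    then have 2: "((\<lambda>x. ee (- (x\<^sup>2) / (2 * \<tau>))) \<longlongrightarrow> 1) (at 0)"
      by (simp add: isCont_def)
    \<comment> \<open>Dividing numerator and denominator by \<open>x\<close> makes the limit of the
      denominator nonzero.\<close>
    have "((\<lambda>x. ee (- (x\<^sup>2) / (2 * \<tau>)) * (jtheta (x / \<tau>) t / (x / \<tau>)) / (jtheta x \<tau> / x) / \<tau>)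
        \<longlongrightarrow> 1 * (- 2 * of_real pi * \<i> * qprod (ee t) (ee t) ^ 2)
          / (- 2 * of_real pi * \<i> * qprod (ee \<tau>) (ee \<tau>) ^ 2) / \<tau>) (at 0)"
      using \<tau> by (intro tendsto_intros 1 2 jtheta_over_id_tendsto) (auto simp: qprod_nonzero)
    also have "1 * (- 2 * of_real pi * \<i> * qprod (ee t) (ee t) ^ 2)
          / (- 2 * of_real pi * \<i> * qprod (ee \<tau>) (ee \<tau>) ^ 2) / \<tau> = c"
      by (simp add: c_def t_def)
    finally show ?thesis
      by (rule Lim_transform_eventually) (auto simp: eventually_at_filter R_def N_def)
  qed
  obtain d where d: "d > 0" "\<And>x. x \<noteq> 0 \<Longrightarrow> norm x < d \<Longrightarrow> jtheta x \<tau> \<noteq> 0"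
    using jtheta_nonzero_near_0[OF \<tau>] by (auto simp: eventually_at dist_norm)
  \<comment> \<open>Within this ball theta vanishes only at 0, where \<open>R\<close> tends to
    \<open>c\<close>, so the singularity is removable.\<close>
  have "(\<lambda>y. if y = 0 then c else R y) holomorphic_on ball 0 d"
    by (intro removable_singularity R_hol lim) (use d(2) in \<open>auto intro: open_delete\<close>)
  then have F0: "F holomorphic_on ball 0 d"
    by (rule holomorphic_transform) (use d(2) \<tau> in \<open>auto simp: F_def\<close>)
  have F_lat: "F (y + of_int m + of_int n * \<tau>) = F y" for y and m n :: int
    using period_of_int[of F 1, OF F_per(1)] period_of_int[of F \<tau>, OF F_per(2)] by simp
  have "F holomorphic_on UNIV"
    unfolding holomorphic_on_def
  proof
    fix z :: complex
    show "F field_differentiable at z within UNIV"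
    proof (cases "jtheta z \<tau> = 0")
      case False
      define A where "A = - ((\<lambda>x. jtheta x \<tau>) -` {0})"
      have "continuous_on UNIV (\<lambda>x. jtheta x \<tau>)"
        by (intro holomorphic_on_imp_continuous_on holomorphic_intros \<tau>) auto
      then have "open A"
        unfolding A_def by (intro open_Compl closed_vimage) (auto simp: continuous_on_eq_continuous_at)
      moreover have "F holomorphic_on A"
        by (rule holomorphic_transform[OF R_hol[OF \<open>open A\<close>]]) (auto simp: A_def F_def)
      ultimately show ?thesis
        using False by (auto simp: A_def intro: holomorphic_on_imp_differentiable_at)
    next
      case True
      then obtain m n :: int where z: "z = of_int m + of_int n * \<tau>"
        using \<tau> by (rule_tac jtheta_eq_0D) auto
      \<comment> \<open>Periodicity carries differentiability from 0 to the lattice point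
        \<open>z\<close>; the point 0 is written \<open>z - z\<close> to fit the chain rule.\<close>
      have "F field_differentiable at (z - z)"
        using F0 d(1) by (intro holomorphic_on_imp_differentiable_at[OF F0]) auto
      moreover have "(\<lambda>x. x - z) field_differentiable at z"
        by (intro derivative_intros)
      ultimately have "(F \<circ> (\<lambda>x. x - z)) field_differentiable at z"
        by (intro field_differentiable_compose)
      moreover have "F \<circ> (\<lambda>x. x - z) = F"
        using F_lat[of "x - z" m n for x] by (auto simp: z fun_eq_iff)
      ultimately show ?thesis
        by simp
    qed
  qed
  from elliptic_entire_constant[OF this \<tau> F_per] obtain k where k: "\<And>x. F x = k"
    by (auto simp: constant_on_def)
  \<comment> \<open>Theta vanishes at 0, so \<open>F 0\<close> is the filled-in value.\<close>
  have "k = c"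
    using k[of 0] \<tau> by (simp add: F_def)
  then have "N x = c * jtheta x \<tau>"
    using k[of x] x by (simp add: F_def R_def field_simps)
  then have "ee (x\<^sup>2 / (2 * \<tau>)) * (ee (- (x\<^sup>2) / (2 * \<tau>)) * jtheta (x / \<tau>) t)
      = ee (x\<^sup>2 / (2 * \<tau>)) * (c * jtheta x \<tau>)"
    by (simp add: N_def)
  then show ?thesis
    by (simp add: ee_minus t_def mult_ac)
qed

section \<open>Half periods and the modulus of the constant\<close>

text \<open>At \<open>\<tau> / 2\<close> and \<open>(1 + \<tau>) / 2\<close> the two products of
  theta coincide, hence the squares in the next lemmas. At 1/2 they coincide once the factor of
  index 0 in \<open>qprod (- 1) (ee \<tau>)\<close>, which is 2, has been split off.\<close>

lemma norm_jtheta_half: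
  assumes "Im \<tau> > 0"
  shows "norm (jtheta (1 / 2) \<tau>) = 2 * norm (qprod (- ee \<tau>) (ee \<tau>)) ^ 2"
proof -
  have "ee (\<tau> - 1 / 2) = - ee \<tau>"
    by (simp add: ee_diff)
  moreover have "qprod (- 1) (ee \<tau>) = 2 * qprod (- ee \<tau>) (ee \<tau>)"
    using qprod_rec[of "ee \<tau>" "- 1"] assms by simp
  ultimately show ?thesis
    by (simp add: jtheta_def norm_mult norm_ee power2_eq_square)
qed

lemma norm_jtheta_half_tau:
  "norm (jtheta (\<tau> / 2) \<tau>) = exp (pi * Im \<tau> / 2) * norm (qprod (ee (\<tau> / 2)) (ee \<tau>)) ^ 2"
proof -
  have "\<tau> - \<tau> / 2 = \<tau> / 2"
    by simp
  then show ?thesis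
    by (simp add: jtheta_def norm_mult norm_ee power2_eq_square)
qed

lemma norm_jtheta_half_one_plus_tau:
  "norm (jtheta ((1 + \<tau>) / 2) \<tau>) = exp (pi * Im \<tau> / 2) * norm (qprod (- ee (\<tau> / 2)) (ee \<tau>)) ^ 2"
proof -
  have "ee ((1 + \<tau>) / 2) = - ee (\<tau> / 2)"
    using ee_add[of "1 / 2" "\<tau> / 2"] by (simp add: add_divide_distrib)
  moreover have "ee (\<tau> - (1 + \<tau>) / 2) = - ee (\<tau> / 2)"
    using ee_diff[of "\<tau> / 2" "1 / 2"] by (simp add: field_simps)
  ultimately show ?thesis
    by (simp add: jtheta_def norm_mult norm_ee power2_eq_square)
qed

text \<open>This is the transformation law of the squared modulus of the eta function, the
  exponential coming from its factor \<open>ee (\<tau> / 24)\<close>. Division by \<tau> carries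
  half periods to half periods, so multiplying three instances of the inversion formula determines
  the modulus of \<open>c\<close>.\<close>

lemma norm_qprod_inversion:
  assumes \<tau>: "Im \<tau> > 0"
  shows "norm (qprod (ee (- 1 / \<tau>)) (ee (- 1 / \<tau>))) ^ 2
    = exp (pi * (Im (- 1 / \<tau>) - Im \<tau>) / 6) * norm \<tau> * norm (qprod (ee \<tau>) (ee \<tau>)) ^ 2"
proof -
  define t where "t = - 1 / \<tau>"
  have t: "Im t > 0"
    unfolding t_def by (rule Im_minus_inverse_pos[OF \<tau>])
  have [simp]: "\<tau> \<noteq> 0" using \<tau> by auto
  define c where "c = qprod (ee t) (ee t) ^ 2 / (\<tau> * qprod (ee \<tau>) (ee \<tau>) ^ 2)"
  \<comment> \<open>\<open>A\<close>, \<open>B\<close> and \<open>D\<close> are the squared moduli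
    of the three factors in \<open>qprod_half_periods\<close>.\<close>
  define A where "A = (\<lambda>\<tau>. norm (qprod (- ee \<tau>) (ee \<tau>)) ^ 2)"
  define B where "B = (\<lambda>\<tau>. norm (qprod (ee (\<tau> / 2)) (ee \<tau>)) ^ 2)"
  define D where "D = (\<lambda>\<tau>. norm (qprod (- ee (\<tau> / 2)) (ee \<tau>)) ^ 2)"
  have ABD: "A z * B z * D z = 1" if "Im z > 0" for z
  proof -
    have "ee z = ee (z / 2) ^ 2"
      using ee_of_nat_mult[of 2 "z / 2"] by simp
    then have "qprod (- ee z) (ee z) * qprod (ee (z / 2)) (ee z) * qprod (- ee (z / 2)) (ee z) = 1"
      using that by (intro qprod_half_periods) auto
    then have "norm (qprod (- ee z) (ee z) * qprod (ee (z / 2)) (ee z) * qprod (- ee (z / 2)) (ee z)) = 1"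
      by simp
    then show ?thesis
      unfolding A_def B_def D_def power_mult_distrib[symmetric] norm_mult by simp
  qed
  have nz: "A \<tau> \<noteq> 0" "B \<tau> \<noteq> 0" "D \<tau> \<noteq> 0"
    using ABD[OF \<tau>] by auto
  have inv: "norm (jtheta (x / \<tau>) t) = norm c * norm (ee (x\<^sup>2 / (2 * \<tau>))) * norm (jtheta x \<tau>)"
    if "jtheta x \<tau> \<noteq> 0" for x
    using jtheta_inversion[OF \<tau> that] unfolding c_def t_def by (simp only: norm_mult)
  \<comment> \<open>The half period -1/2 is chosen because its quotient by \<tau> is exactly
    \<open>t / 2\<close>.\<close>
  have norm_half: "norm (jtheta (- 1 / 2) \<tau>) = 2 * A \<tau>"
    using norm_jtheta_half[OF \<tau>] jtheta_plus_1[of "- 1 / 2" \<tau>] by (simp add: A_def)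
  have e1: "exp (pi * Im t / 2) * B t = norm c * exp (pi * Im t / 4) * (2 * A \<tau>)"
  proof -
    have nz1: "jtheta (- 1 / 2) \<tau> \<noteq> 0"
      using norm_half nz by (metis mult_eq_0_iff norm_zero zero_neq_numeral)
    have x1: "(- 1 / 2) / \<tau> = t / 2"
      by (simp add: t_def)
    have "(- 1 / 2)\<^sup>2 / (2 * \<tau>) = - t / 8"
      by (simp add: t_def field_simps power2_eq_square)
    then have n1: "norm (ee ((- 1 / 2)\<^sup>2 / (2 * \<tau>))) = exp (pi * Im t / 4)"
      unfolding norm_ee by simp
    show ?thesis
      using inv[OF nz1] unfolding x1 n1 norm_half norm_jtheta_half_tau by (simp only: B_def)
  qed
  \<comment> \<open>The half period \<open>\<tau> / 2\<close> is carried to 1/2.\<close>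
  have e2: "2 * A t = norm c * exp (- pi * Im \<tau> / 4) * (exp (pi * Im \<tau> / 2) * B \<tau>)"
  proof -
    have "jtheta (\<tau> / 2) \<tau> \<noteq> 0"
      using norm_jtheta_half_tau[of \<tau>] nz by (auto simp: B_def)
    moreover have "norm (ee ((\<tau> / 2)\<^sup>2 / (2 * \<tau>))) = exp (- pi * Im \<tau> / 4)"
    proof -
      have eq: "(\<tau> / 2)\<^sup>2 / (2 * \<tau>) = \<tau> / 8"
        by (simp add: field_simps power2_eq_square)
      show ?thesis
        unfolding norm_ee eq by simp
    qed
    ultimately show ?thesis
      using inv[of "\<tau> / 2"] norm_jtheta_half[OF t] norm_jtheta_half_tau[of \<tau>] by (simp add: A_def B_def)
  qed
  \<comment> \<open>The half period \<open>(\<tau> - 1) / 2\<close>, which differs from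
    \<open>(1 + \<tau>) / 2\<close> by the period 1, is carried to
    \<open>(1 + t) / 2\<close>.\<close>
  have e3: "exp (pi * Im t / 2) * D t = norm c * exp (- pi * (Im \<tau> - Im t) / 4) * (exp (pi * Im \<tau> / 2) * D \<tau>)"
  proof -
    have "jtheta ((1 + \<tau>) / 2) \<tau> = - jtheta ((\<tau> - 1) / 2) \<tau>"
      using jtheta_plus_1[of "(\<tau> - 1) / 2" \<tau>] by (simp add: field_simps)
    then have *: "norm (jtheta ((\<tau> - 1) / 2) \<tau>) = exp (pi * Im \<tau> / 2) * D \<tau>"
      using norm_jtheta_half_one_plus_tau[of \<tau>] by (simp add: D_def)
    then have nz3: "jtheta ((\<tau> - 1) / 2) \<tau> \<noteq> 0"
      using nz by auto
    have x3: "(\<tau> - 1) / 2 / \<tau> = (1 + t) / 2"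
      by (simp add: t_def field_simps)
    have eq: "((\<tau> - 1) / 2)\<^sup>2 / (2 * \<tau>) = (\<tau> - 2 - t) / 8"
      by (simp add: t_def field_simps power2_eq_square)
    have n3: "norm (ee (((\<tau> - 1) / 2)\<^sup>2 / (2 * \<tau>))) = exp (- pi * (Im \<tau> - Im t) / 4)"
      unfolding norm_ee eq by simp
    show ?thesis
      using inv[OF nz3] unfolding x3 n3 * norm_jtheta_half_one_plus_tau by (simp only: D_def)
  qed
  \<comment> \<open>In the product of \<open>e1\<close>, \<open>e2\<close> and \<open>e3\<close> the
    factors \<open>A * B * D\<close> are 1 on both sides, leaving
    \<open>norm c ^ 3 = exp (pi * (Im t - Im \<tau>) / 2)\<close>.\<close>
  have "exp (pi * Im t) * 2 * (A t * B t * D t)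
      = (exp (pi * Im t / 2) * B t) * (2 * A t) * (exp (pi * Im t / 2) * D t)"
    by (simp add: exp_add[symmetric])
  also have "\<dots> = norm c ^ 3 * 2 * (A \<tau> * B \<tau> * D \<tau>) * (exp (pi * Im t / 4) * exp (- pi * Im \<tau> / 4)
      * exp (pi * Im \<tau> / 2) * exp (- pi * (Im \<tau> - Im t) / 4) * exp (pi * Im \<tau> / 2))"
    unfolding e1 e2 e3 by (simp add: power3_eq_cube mult_ac)
  also have "exp (pi * Im t / 4) * exp (- pi * Im \<tau> / 4)
      * exp (pi * Im \<tau> / 2) * exp (- pi * (Im \<tau> - Im t) / 4) * exp (pi * Im \<tau> / 2)
      = exp (pi * Im t / 2 + pi * Im \<tau> / 2)"
    unfolding exp_add[symmetric] by (simp add: field_simps)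
  finally have "exp (pi * Im t) = norm c ^ 3 * exp (pi * Im t / 2 + pi * Im \<tau> / 2)"
    by (simp add: ABD \<tau> t)
  then have "norm c ^ 3 = exp (pi * Im t) / exp (pi * Im t / 2 + pi * Im \<tau> / 2)"
    by (simp add: field_simps)
  also have "\<dots> = exp (pi * (Im t - Im \<tau>) / 6) ^ 3"
    by (simp add: exp_diff[symmetric] exp_of_nat_mult[symmetric] field_simps)
  finally have "norm c = exp (pi * (Im t - Im \<tau>) / 6)"
    by (rule power_eq_imp_eq_base) auto
  then show ?thesis
    using \<tau> qprod_nonzero[of "ee \<tau>" "ee \<tau>"] unfolding c_def t_def[symmetric]
    by (simp add: norm_divide norm_mult norm_power field_simps)
qed

subsection \<open>Growth of the Euler product\<close>

text \<open>This is \<open>Im \<tau> * \<bar>\<eta> \<tau>\<bar> ^ 4\<close> for the Dedekind eta function.\<close>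

definition eta_height :: "complex \<Rightarrow> real" where
  "eta_height \<tau> = Im \<tau> * exp (- pi * Im \<tau> / 3) * norm (qprod (ee \<tau>) (ee \<tau>)) ^ 4"

text \<open>The denominator of \<open>Im (- 1 / \<tau>) = Im \<tau> / norm \<tau> ^ 2\<close>
  cancels the factor \<open>norm \<tau> ^ 2\<close> produced by squaring
  \<open>norm_qprod_inversion\<close>.\<close>

lemma eta_height_inversion:
  assumes \<tau>: "Im \<tau> > 0"
  shows "eta_height (- 1 / \<tau>) = eta_height \<tau>"
proof -
  define t where "t = - 1 / \<tau>"
  have \<tau>0: "norm \<tau> > 0"
    using \<tau> by auto
  have Im_t: "Im t = Im \<tau> / norm \<tau> ^ 2"
    by (simp add: t_def Im_divide cmod_power2)
  have "norm (qprod (ee t) (ee t)) ^ 4 = (norm (qprod (ee t) (ee t)) ^ 2) ^ 2"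
    by simp
  also have "\<dots> = exp (pi * (Im t - Im \<tau>) / 3) * norm \<tau> ^ 2 * norm (qprod (ee \<tau>) (ee \<tau>)) ^ 4"
    unfolding t_def norm_qprod_inversion[OF \<tau>]
    by (simp add: power_mult_distrib exp_of_nat_mult[symmetric])
  finally have "eta_height t = Im \<tau> * (exp (- pi * Im t / 3) * exp (pi * (Im t - Im \<tau>) / 3))
      * norm (qprod (ee \<tau>) (ee \<tau>)) ^ 4 * (norm \<tau> ^ 2 / norm \<tau> ^ 2)"
    by (simp add: eta_height_def Im_t)
  also have "exp (- pi * Im t / 3) * exp (pi * (Im t - Im \<tau>) / 3) = exp (- pi * Im \<tau> / 3)"
    by (simp add: exp_add[symmetric] field_simps)
  finally show ?thesis
    using \<tau>0 by (simp add: t_def eta_height_def)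
qed

lemma eta_height_minus_of_int: "eta_height (\<tau> - of_int n) = eta_height \<tau>"
proof -
  have "ee (of_int n) = 1"
    by (auto simp: ee_eq_1_iff)
  then show ?thesis
    by (simp add: eta_height_def ee_diff)
qed

text \<open>Here \<open>norm (ee \<tau>)\<close> is at most 1/2, so the product is at most
  \<open>exp 1\<close>, which enters to the fourth power. The remaining factor is at most 1 because
  \<pi> > 3.\<close>

lemma eta_height_le_high:
  assumes "Im \<tau> \<ge> 1 / 2"
  shows "eta_height \<tau> \<le> exp 4"
proof -
  have "norm (ee \<tau>) \<le> exp (- 1)"
    unfolding norm_ee using mult_mono[of 3 pi "1 / 2" "Im \<tau>"] assms pi_gt3 by (subst exp_le_cancel_iff) auto
  also have "exp (- 1 :: real) \<le> 1 / 2"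
    using exp_ge_add_one_self[of "1 :: real"] by (simp add: exp_minus field_simps)
  finally have q: "norm (ee \<tau>) \<le> 1 / 2" .
  then have "norm (ee \<tau>) / (1 - norm (ee \<tau>)) \<le> 1"
    by (simp add: field_simps)
  then have "norm (qprod (ee \<tau>) (ee \<tau>)) \<le> exp 1"
    using norm_qprod_le[of "ee \<tau>" "ee \<tau>"] q by (smt (verit) exp_le_cancel_iff field_sum_of_halves zero_less_one)
  then have 1: "norm (qprod (ee \<tau>) (ee \<tau>)) ^ 4 \<le> exp 1 ^ 4"
    by (intro power_mono) auto
  have "Im \<tau> \<le> exp (Im \<tau>)"
    using exp_ge_add_one_self[of "Im \<tau>"] by linarith
  also have "\<dots> \<le> exp (pi * Im \<tau> / 3)"
    using mult_right_mono[of 3 pi "Im \<tau>"] assms pi_gt3 by auto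
  finally have 2: "Im \<tau> * exp (- pi * Im \<tau> / 3) \<le> 1"
    by (simp add: exp_minus field_simps)
  have "eta_height \<tau> \<le> 1 * exp 1 ^ 4"
    unfolding eta_height_def using 1 2 assms by (intro mult_mono) auto
  then show ?thesis
    by (simp add: exp_of_nat_mult[symmetric])
qed

lemma eta_height_le:
  assumes "Im \<tau> > 0"
  shows "eta_height \<tau> \<le> exp 4"
proof -
  \<comment> \<open>Induction on the number of doublings that bring the imaginary part up to
    1/2.\<close>
  have "eta_height \<tau> \<le> exp 4" if "Im \<tau> \<ge> (1 / 2) ^ Suc n" for n
    using that
  proof (induction n arbitrary: \<tau>)
    case 0
    then show ?case by (simp add: eta_height_le_high)
  next
    case (Suc n)
    show ?case
    proof (cases "Im \<tau> \<ge> 1 / 2")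
      case True
      then show ?thesis by (rule eta_height_le_high)
    next
      case False
      define z where "z = \<tau> - of_int (round (Re \<tau>))"
      have pos: "Im \<tau> > 0"
        using Suc.prems by (smt (verit) half_gt_zero_iff zero_less_one zero_less_power)
      have z: "Im z = Im \<tau>" "\<bar>Re z\<bar> \<le> 1 / 2"
        using of_int_round_abs_le[of "Re \<tau>"] by (auto simp: z_def abs_minus_commute)
      \<comment> \<open>Both coordinates of \<open>z\<close> are at most 1/2 in absolute value, so
        \<open>norm z ^ 2\<close> is at most 1/2 and inversion at least doubles the imaginary
        part.\<close>
      have "norm z ^ 2 \<le> (1 / 2) ^ 2 + (1 / 2) ^ 2"
        unfolding cmod_power2 using z False pos by (intro add_mono power2_le_iff_abs_le[THEN iffD2]) auto
      then have "norm z ^ 2 \<le> 1 / 2"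
        by (simp add: power2_eq_square)
      moreover have "norm z ^ 2 > 0"
        using z pos by auto
      ultimately have "2 * Im z \<le> Im z / norm z ^ 2"
        using z pos mult_left_mono[of "norm z ^ 2" "1 / 2" "2 * Im z"] by (simp add: field_simps)
      also have "\<dots> = Im (- 1 / z)"
        by (simp add: Im_divide cmod_power2)
      finally have "Im (- 1 / z) \<ge> (1 / 2) ^ Suc n"
        using Suc.prems z by simp
      from Suc.IH[OF this] have "eta_height z \<le> exp 4"
        using z pos by (simp only: eta_height_inversion)
      then show ?thesis
        by (simp add: z_def eta_height_minus_of_int)
    qed
  qed
  moreover obtain n where "(1 / 2) ^ n < Im \<tau>"
    using real_arch_pow_inv[OF assms, of "1 / 2"] by auto
  then have "(1 / 2) ^ Suc n \<le> Im \<tau>"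
    using assms by simp
  ultimately show ?thesis
    by blast
qed

text \<open>Choose \<tau> with \<open>ee \<tau> = w\<close>, so that
  \<open>Im \<tau> = t / (2 * pi)\<close>, solve \<open>eta_height_le\<close> for the fourth power
  of the product, and take fourth roots.\<close>

lemma norm_qprod_diagonal_le:
  assumes w: "norm w = exp (- t)" and t: "0 < t" "t \<le> 1"
  shows "norm (qprod w w) \<le> (8 * exp 5) powr (1 / 4) * t powr (- 1 / 4)"
proof -
  define \<tau> where "\<tau> = Ln w / (2 * of_real pi * \<i>)"
  have w0: "w \<noteq> 0"
    using w by auto
  have ee: "ee \<tau> = w"
    using w0 by (simp add: ee_def \<tau>_def)
  have "Re (Ln w) = - t"
    using w0 w by simp
  then have Im: "Im \<tau> = t / (2 * pi)"
    by (simp add: \<tau>_def Im_divide_of_real[symmetric] Im_divide power2_eq_square)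
  have "eta_height \<tau> \<le> exp 4"
    using t Im by (intro eta_height_le) auto
  then have "t / (2 * pi) * exp (- t / 6) * norm (qprod w w) ^ 4 \<le> exp 4"
    by (simp add: eta_height_def ee Im)
  then have "norm (qprod w w) ^ 4 \<le> 2 * pi * (exp 4 * exp (t / 6)) / t"
    using t by (simp add: field_simps exp_minus)
  \<comment> \<open>\<open>2 * pi < 8\<close>, and \<open>4 + t / 6 \<le> 5\<close> by
    \<open>t \<le> 1\<close>.\<close>
  also have "\<dots> \<le> 8 * exp 5 / t"
    unfolding exp_add[symmetric] using t pi_less_4 by (intro divide_right_mono mult_mono) auto
  finally have "norm (qprod w w) ^ 4 \<le> 8 * exp 5 / t" .
  then have "(norm (qprod w w) ^ 4) powr (1 / 4) \<le> (8 * exp 5 / t) powr (1 / 4)"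
    by (intro powr_mono2) auto
  also have "(norm (qprod w w) ^ 4) powr (1 / 4) = norm (qprod w w)"
    by (cases "qprod w w = 0") (simp_all add: powr_powr flip: powr_numeral)
  also have "(8 * exp 5 / t) powr (1 / 4) = (8 * exp 5) powr (1 / 4) * t powr (- 1 / 4)"
    using t by (simp add: powr_divide powr_minus field_simps)
  finally show ?thesis .
qed

section \<open>Integer Taylor coefficients of the Euler product\<close>

lemma fps_nth_prod_one_minus_X_power_in_Ints:
  "fps_nth (\<Prod>k<N. 1 - fps_X * fps_X ^ k :: complex fps) n \<in> \<int>"
proof (induction N arbitrary: n)
  case (Suc N)
  have "fps_nth (1 - fps_X * fps_X ^ N :: complex fps) i \<in> \<int>" for i
    by (simp flip: power_Suc)
  then show ?case
    unfolding prod.lessThan_Suc fps_mult_nth by (intro Ints_sum Ints_mult Suc)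
qed auto

text \<open>The Taylor coefficients are limits of those of the partial products, which are
  polynomials over the integers, and the set of integers is closed.\<close>

lemma higher_deriv_qprod_diagonal_in_Ints:
  "(deriv ^^ n) (\<lambda>w. qprod w w) 0 / fact n \<in> \<int>"
proof -
  have "uniform_limit (cball 0 (1/2)) (\<lambda>n x. \<Prod>k<n. 1 - x * x ^ k) (\<lambda>x. qprod x x) sequentially"
    by (rule uniform_limit_qprod) (auto intro!: continuous_intros)
  then have "uniform_limit (ball 0 (1/2)) (\<lambda>n x. \<Prod>k<n. 1 - x * x ^ k) (\<lambda>x. qprod x x) sequentially"
    by (rule uniform_limit_on_subset) auto
  then have "(\<lambda>N. (deriv ^^ n) (\<lambda>x. \<Prod>k<N. 1 - x * x ^ k) 0) \<longlonglongrightarrow> (deriv ^^ n) (\<lambda>x. qprod x x) 0"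
    by (rule higher_deriv_complex_uniform_limit) (auto intro!: always_eventually holomorphic_intros)
  then have lim: "(\<lambda>N. (deriv ^^ n) (\<lambda>x. \<Prod>k<N. 1 - x * x ^ k) 0 / fact n)
      \<longlonglongrightarrow> (deriv ^^ n) (\<lambda>x. qprod x x) 0 / fact n"
    by (intro tendsto_intros) auto
  have mem: "(deriv ^^ n) (\<lambda>x. \<Prod>k<N. 1 - x * x ^ k) 0 / fact n \<in> (\<int> :: complex set)" for N
  proof -
    have "(\<lambda>x::complex. \<Prod>k<N. 1 - x * x ^ k) has_fps_expansion (\<Prod>k<N. 1 - fps_X * fps_X ^ k)"
      by (intro fps_expansion_intros)
    from fps_nth_fps_expansion[OF this, of n] show ?thesis
      using fps_nth_prod_one_minus_X_power_in_Ints[of N n] by (simp only:)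
  qed
  show ?thesis
    by (rule closed_sequentially[OF closed_Ints mem lim])
qed

lemma qprod_diagonal_holomorphic: "(\<lambda>w. qprod w w) holomorphic_on ball 0 1"
  by (rule holomorphic_on_qprod) auto

text \<open>Since \<open>euler_coeff\<close> is a definite description over integer sequences,
  existence comes from the integrality of the Taylor coefficients, and uniqueness from that of power
  series expansions.\<close>

lemma euler_coeff_sums:
  assumes "norm w < 1"
  shows "(\<lambda>n. of_int (euler_coeff n) * w ^ n) sums qprod w w"
proof -
  define P where "P = (\<lambda>a. \<forall>w::complex. norm w < 1 \<longrightarrow> (\<lambda>n. of_int (a n) * w ^ n) sums (\<Prod>k. (1 - w ^ Suc k)))"
  have P: "P a \<longleftrightarrow> (\<forall>w. norm w < 1 \<longrightarrow> (\<lambda>n. of_int (a n) * w ^ n) sums qprod w w)" for a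
    by (simp add: P_def qprod_def)
  have "\<forall>n. \<exists>k::int. (deriv ^^ n) (\<lambda>w. qprod w w) 0 / fact n = of_int k"
    using higher_deriv_qprod_diagonal_in_Ints by (metis Ints_cases)
  then obtain a :: "nat \<Rightarrow> int" where a: "\<And>n. (deriv ^^ n) (\<lambda>w. qprod w w) 0 / fact n = of_int (a n)"
    by metis
  have "P a"
    unfolding P using holomorphic_power_series[OF qprod_diagonal_holomorphic] by (simp add: a)
  moreover have "b = a" if "P b" for b
  proof -
    have "(\<lambda>w. qprod w w) has_fps_expansion Abs_fps (\<lambda>n. of_int (c n))" if "P c" for c
    proof (rule has_fps_expansionI)
      have "eventually (\<lambda>u. u \<in> ball 0 1) (nhds (0::complex))"
        by (intro eventually_nhds_in_open) auto
      then show "\<forall>\<^sub>F u in nhds 0. (\<lambda>n. fps_nth (Abs_fps (\<lambda>n. of_int (c n))) n * u ^ n) sums qprod u u"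
        by eventually_elim (use that in \<open>auto simp: P\<close>)
    qed
    from this[OF \<open>P b\<close>] this[OF \<open>P a\<close>]
    have "Abs_fps (\<lambda>n. of_int (b n) :: complex) = Abs_fps (\<lambda>n. of_int (a n))"
      by (metis fps_expansion_unique_complex)
    then show ?thesis
      by (auto simp: fps_eq_iff)
  qed
  ultimately have "P (THE a. P a)"
    by (rule theI)
  then have "P euler_coeff"
    by (simp add: euler_coeff_def P_def)
  with assms show ?thesis
    by (simp add: P)
qed

subsection \<open>Toeplitz forms and their symbols\<close>

text \<open>The bound on \<open>d\<close> leaves 0 as the only multiple of \<open>N\<close>;
  otherwise this is a full geometric sum over an \<open>N\<close>-th root of unity different from
  1.\<close>

lemma sum_ee_roots_of_unity:
  fixes d :: int and N :: nat
  assumes "\<bar>d\<bar> < int N"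
  shows "(\<Sum>j<N. ee (of_int d * of_nat j / of_nat N)) = (if d = 0 then of_nat N else 0)"
proof (cases "d = 0")
  case False
  define x where "x = ee (of_int d / of_nat N)"
  have N: "N > 0"
    using assms by auto
  have pow: "ee (of_int d * of_nat j / of_nat N) = x ^ j" for j
    unfolding x_def ee_of_nat_mult[symmetric] by (simp add: mult_ac)
  have "x \<noteq> 1"
  proof
    assume "x = 1"
    then obtain n :: int where "of_int d / of_nat N = (of_int n :: complex)"
      unfolding x_def ee_eq_1_iff by blast
    then have "of_int d = (of_int (n * int N) :: complex)"
      using N by (simp add: field_simps)
    then have "d = n * int N"
      by (simp only: of_int_eq_iff)
    with assms False show False
      using zdvd_not_zless[of "\<bar>d\<bar>" "int N"] by auto
  qed
  moreover have "x ^ N = 1"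
    using N ee_eq_1_iff[of "of_int d"] by (simp add: pow[symmetric])
  ultimately show ?thesis
    using False by (simp add: pow sum_gp_strict)
qed auto

text \<open>The frequencies in \<open>A\<close> are distinct modulo \<open>N\<close>, so after
  expanding the square, orthogonality leaves only the diagonal terms.\<close>

lemma Parseval_roots_of_unity:
  fixes g :: "int \<Rightarrow> complex"
  assumes "finite A" "\<And>l m. l \<in> A \<Longrightarrow> m \<in> A \<Longrightarrow> \<bar>l - m\<bar> < int N"
  shows "(\<Sum>j<N. norm (\<Sum>l\<in>A. g l * ee (of_int l * of_nat j / of_nat N)) ^ 2)
    = of_nat N * (\<Sum>l\<in>A. norm (g l) ^ 2)"
proof -
  define e where "e = (\<lambda>l j. ee (of_int l * of_nat j / of_nat N))"
  have cnj_e: "e l j * cnj (e m j) = e (l - m) j" for l m j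
    by (simp add: e_def cnj_ee ee_add[symmetric] diff_divide_distrib algebra_simps)
  have "complex_of_real (\<Sum>j<N. norm (\<Sum>l\<in>A. g l * e l j) ^ 2)
      = (\<Sum>j<N. (\<Sum>l\<in>A. g l * e l j) * cnj (\<Sum>m\<in>A. g m * e m j))"
    by (simp only: of_real_sum complex_norm_square)
  also have "\<dots> = (\<Sum>j<N. \<Sum>l\<in>A. \<Sum>m\<in>A. g l * cnj (g m) * e (l - m) j)"
    unfolding cnj_sum sum_product cnj_e[symmetric] by (simp add: mult_ac)
  also have "\<dots> = (\<Sum>l\<in>A. \<Sum>j<N. \<Sum>m\<in>A. g l * cnj (g m) * e (l - m) j)"
    by (rule sum.swap)
  also have "\<dots> = (\<Sum>l\<in>A. \<Sum>m\<in>A. g l * cnj (g m) * (\<Sum>j<N. e (l - m) j))"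
    unfolding sum_distrib_left by (intro sum.cong refl sum.swap)
  also have "\<dots> = (\<Sum>l\<in>A. \<Sum>m\<in>A. g l * cnj (g m) * (if l = m then of_nat N else 0))"
    unfolding e_def using assms(2) by (intro sum.cong refl) (subst sum_ee_roots_of_unity, auto)
  also have "\<dots> = of_real (of_nat N * (\<Sum>l\<in>A. norm (g l) ^ 2))"
    unfolding of_real_mult of_real_sum complex_norm_square using assms(1)
    by (simp add: if_distrib[of "\<lambda>x. _ * x"] sum_distrib_left mult_ac cong: if_cong)
  finally show ?thesis
    unfolding e_def of_real_eq_iff .
qed

text \<open>Averaging over the \<open>N\<close>-th roots of unity, in place of integrating over the
  circle, encodes the condition \<open>int n + l = m\<close>. The form becomes the mean of
  \<open>T j * G j * H j\<close>, where \<open>T\<close> is bounded by \<open>S\<close> and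
  Cauchy-Schwarz with Parseval handles \<open>G\<close> and \<open>H\<close>.\<close>

lemma toeplitz_form_le_finite:
  fixes g h :: "int \<Rightarrow> complex" and b :: "nat \<Rightarrow> complex"
  assumes A: "finite A" and S: "\<And>w. norm w = 1 \<Longrightarrow> norm (\<Sum>n\<le>M. b n * w ^ n) \<le> S"
  shows "norm (\<Sum>n\<le>M. \<Sum>l\<in>A. \<Sum>m\<in>A. if int n + l = m then b n * g l * h m else 0)
    \<le> S * L2_set (\<lambda>l. norm (g l)) A * L2_set (\<lambda>m. norm (h m)) A"
proof -
  define R where "R = (\<Sum>l\<in>A. \<bar>l\<bar>)"
  have R: "\<bar>l\<bar> \<le> R" if "l \<in> A" for l
    unfolding R_def using A that by (intro member_le_sum) auto
  have "R \<ge> 0"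
    unfolding R_def by (intro sum_nonneg) auto
  \<comment> \<open>Large enough that every \<open>int n + l - m\<close> and every
    \<open>l - m\<close> has absolute value below \<open>N\<close>.\<close>
  define N where "N = M + 2 * nat R + 1"
  have N: "N > 0"
    by (simp add: N_def)
  have RN: "\<bar>l - m\<bar> < int N" if "l \<in> A" "m \<in> A" for l m
    using R[OF that(1)] R[OF that(2)] \<open>R \<ge> 0\<close> by (simp add: N_def)
  define e where "e = (\<lambda>l j. ee (of_int l * of_nat j / of_nat N))"
  have e_add: "e (l + m) j = e l j * e m j" for l m j
    by (simp add: e_def ee_add[symmetric] algebra_simps add_divide_distrib)
  have e_pow: "e (int n) j = e 1 j ^ n" for n j
    by (simp add: e_def ee_of_nat_mult[symmetric])
  have norm_e: "norm (e 1 j) = 1" for j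
    by (simp add: e_def norm_ee)
  define G where "G = (\<lambda>j. \<Sum>l\<in>A. g l * e l j)"
  define H where "H = (\<lambda>j. \<Sum>m\<in>A. h m * e (- m) j)"
  define T where "T = (\<lambda>j. \<Sum>n\<le>M. b n * e 1 j ^ n)"
  have G: "L2_set (\<lambda>j. norm (G j)) {..<N} = sqrt N * L2_set (\<lambda>l. norm (g l)) A"
  proof -
    have "(\<Sum>j<N. norm (G j) ^ 2) = N * (\<Sum>l\<in>A. norm (g l) ^ 2)"
      unfolding G_def e_def by (intro Parseval_roots_of_unity A RN)
    then show ?thesis
      by (simp add: L2_set_def real_sqrt_mult)
  qed
  have H: "L2_set (\<lambda>j. norm (H j)) {..<N} = sqrt N * L2_set (\<lambda>l. norm (h l)) A"
  proof -
    \<comment> \<open>Changing the sign of the index brings \<open>H\<close> into the form that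
      Parseval requires.\<close>
    have H': "H j = (\<Sum>m\<in>uminus ` A. h (- m) * e m j)" for j
      unfolding H_def by (subst sum.reindex) (auto simp: inj_on_def)
    have "(\<Sum>j<N. norm (H j) ^ 2) = N * (\<Sum>l\<in>uminus ` A. norm (h (- l)) ^ 2)"
      unfolding H' e_def using A RN by (intro Parseval_roots_of_unity) (auto simp: abs_minus_commute)
    also have "(\<Sum>l\<in>uminus ` A. norm (h (- l)) ^ 2) = (\<Sum>l\<in>A. norm (h l) ^ 2)"
      by (subst sum.reindex) (auto simp: inj_on_def)
    finally show ?thesis
      by (simp add: L2_set_def real_sqrt_mult)
  qed
  have "(\<Sum>j<N. T j * G j * H j)
      = (\<Sum>j<N. \<Sum>n\<le>M. \<Sum>l\<in>A. \<Sum>m\<in>A. b n * g l * h m * e (int n + l - m) j)"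
  proof (rule sum.cong[OF refl])
    fix j
    have "T j * G j * H j = (\<Sum>n\<le>M. \<Sum>l\<in>A. b n * e 1 j ^ n * (g l * e l j)) * H j"
      by (simp only: T_def G_def sum_product)
    also have "\<dots> = (\<Sum>n\<le>M. \<Sum>l\<in>A. \<Sum>m\<in>A. b n * e 1 j ^ n * (g l * e l j) * (h m * e (- m) j))"
      by (simp only: H_def sum_distrib_right) (simp only: sum_distrib_left)
    also have "\<dots> = (\<Sum>n\<le>M. \<Sum>l\<in>A. \<Sum>m\<in>A. b n * g l * h m * e (int n + l - m) j)"
      unfolding diff_conv_add_uminus e_add e_pow by (simp only: mult_ac)
    finally show "T j * G j * H j = (\<Sum>n\<le>M. \<Sum>l\<in>A. \<Sum>m\<in>A. b n * g l * h m * e (int n + l - m) j)" .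
  qed
  also have "\<dots> = (\<Sum>n\<le>M. \<Sum>j<N. \<Sum>l\<in>A. \<Sum>m\<in>A. b n * g l * h m * e (int n + l - m) j)"
    by (rule sum.swap)
  also have "\<dots> = (\<Sum>n\<le>M. \<Sum>l\<in>A. \<Sum>j<N. \<Sum>m\<in>A. b n * g l * h m * e (int n + l - m) j)"
    by (intro sum.cong refl sum.swap)
  also have "\<dots> = (\<Sum>n\<le>M. \<Sum>l\<in>A. \<Sum>m\<in>A. b n * g l * h m * (\<Sum>j<N. e (int n + l - m) j))"
    unfolding sum_distrib_left by (intro sum.cong refl sum.swap)
  also have "\<dots> = (\<Sum>n\<le>M. \<Sum>l\<in>A. \<Sum>m\<in>A. b n * g l * h m * (if int n + l = m then of_nat N else 0))"
  proof (intro sum.cong refl)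
    fix n l m assume "n \<in> {..M}" "l \<in> A" "m \<in> A"
    then have "\<bar>int n + l - m\<bar> < int N"
      using R[of l] R[of m] \<open>R \<ge> 0\<close> by (auto simp: N_def)
    from sum_ee_roots_of_unity[OF this]
    show "b n * g l * h m * (\<Sum>j<N. e (int n + l - m) j)
        = b n * g l * h m * (if int n + l = m then of_nat N else 0)"
      by (auto simp: e_def)
  qed
  also have "\<dots> = of_nat N * (\<Sum>n\<le>M. \<Sum>l\<in>A. \<Sum>m\<in>A. if int n + l = m then b n * g l * h m else 0)"
    unfolding sum_distrib_left by (intro sum.cong refl) auto
  finally have eq: "of_nat N * (\<Sum>n\<le>M. \<Sum>l\<in>A. \<Sum>m\<in>A. if int n + l = m then b n * g l * h m else 0)
      = (\<Sum>j<N. T j * G j * H j)" ..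
  have "S \<ge> 0"
    using order_trans[OF norm_ge_zero S[of 1]] by simp
  have "norm (\<Sum>j<N. T j * G j * H j) \<le> (\<Sum>j<N. S * (\<bar>norm (G j)\<bar> * \<bar>norm (H j)\<bar>))"
    unfolding T_def by (rule sum_norm_le) (auto simp: norm_mult mult.assoc intro!: mult_right_mono S norm_e)
  also have "\<dots> \<le> S * (L2_set (\<lambda>j. norm (G j)) {..<N} * L2_set (\<lambda>j. norm (H j)) {..<N})"
    unfolding sum_distrib_left[symmetric] using \<open>S \<ge> 0\<close> by (intro mult_left_mono L2_set_mult_ineq)
  \<comment> \<open>The two factors \<open>sqrt N\<close> from Parseval cancel the \<open>N\<close>
    in \<open>eq\<close>.\<close>
  also have "\<dots> = real N * (S * L2_set (\<lambda>l. norm (g l)) A * L2_set (\<lambda>m. norm (h m)) A)"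
    unfolding G H by simp
  finally show ?thesis
    unfolding eq[symmetric] norm_mult using N by simp
qed

text \<open>Truncate the coefficients at \<open>M\<close>. The truncated symbol exceeds
  \<open>S\<close> by at most the tail, while for \<open>M \<ge> 2 * R\<close> the form is unchanged
  because all \<open>m - l\<close> are at most \<open>M\<close>. Then let \<open>M\<close> tend to
  infinity.\<close>

lemma toeplitz_form_le:
  fixes g h :: "int \<Rightarrow> complex" and b :: "nat \<Rightarrow> complex"
  assumes A: "finite A" and b: "summable (\<lambda>n. norm (b n))"
    and S: "\<And>w. norm w = 1 \<Longrightarrow> norm (\<Sum>n. b n * w ^ n) \<le> S"
  shows "norm (\<Sum>l\<in>A. \<Sum>m\<in>A. if l \<le> m then b (nat (m - l)) * g l * h m else 0)
    \<le> S * L2_set (\<lambda>l. norm (g l)) A * L2_set (\<lambda>m. norm (h m)) A"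
proof (rule LIMSEQ_le_const)
  let ?g = "L2_set (\<lambda>l. norm (g l)) A" and ?h = "L2_set (\<lambda>m. norm (h m)) A"
  let ?tail = "\<lambda>M. \<Sum>n. norm (b (n + Suc M))"
  have "(\<lambda>M. \<Sum>n. norm (b (n + M))) \<longlonglongrightarrow> 0"
    using b by (rule suminf_exist_split2)
  then have "?tail \<longlonglongrightarrow> 0"
    by (rule LIMSEQ_Suc)
  then have "(\<lambda>M. (S + ?tail M) * ?g * ?h) \<longlonglongrightarrow> (S + 0) * ?g * ?h"
    by (intro tendsto_intros)
  then show "(\<lambda>M. (S + ?tail M) * ?g * ?h) \<longlonglongrightarrow> S * ?g * ?h"
    by simp
  define R where "R = (\<Sum>l\<in>A. \<bar>l\<bar>)"
  have R: "\<bar>l\<bar> \<le> R" if "l \<in> A" for l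
    unfolding R_def using A that by (intro member_le_sum) auto
  have "norm (\<Sum>l\<in>A. \<Sum>m\<in>A. if l \<le> m then b (nat (m - l)) * g l * h m else 0) \<le> (S + ?tail M) * ?g * ?h"
    if M: "M \<ge> nat (2 * R)" for M
  proof -
    have "(\<Sum>n\<le>M. \<Sum>l\<in>A. \<Sum>m\<in>A. if int n + l = m then b n * g l * h m else 0)
        = (\<Sum>l\<in>A. \<Sum>n\<le>M. \<Sum>m\<in>A. if int n + l = m then b n * g l * h m else 0)"
      by (rule sum.swap)
    also have "\<dots> = (\<Sum>l\<in>A. \<Sum>m\<in>A. \<Sum>n\<le>M. if int n + l = m then b n * g l * h m else 0)"
      by (intro sum.cong refl sum.swap)
    also have "\<dots> = (\<Sum>l\<in>A. \<Sum>m\<in>A. if l \<le> m then b (nat (m - l)) * g l * h m else 0)"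
    proof (intro sum.cong refl)
      fix l m assume "l \<in> A" "m \<in> A"
      then have "m - l \<le> int M"
        using R[of l] R[of m] M by linarith
      show "(\<Sum>n\<le>M. if int n + l = m then b n * g l * h m else 0)
          = (if l \<le> m then b (nat (m - l)) * g l * h m else 0)"
      proof (cases "l \<le> m")
        case True
        then have "(\<Sum>n\<le>M. if int n + l = m then b n * g l * h m else 0)
            = (\<Sum>n\<le>M. if n = nat (m - l) then b n * g l * h m else 0)"
          by (intro sum.cong) auto
        with True \<open>m - l \<le> int M\<close> show ?thesis
          by simp
      next
        case False
        then show ?thesis
          by (auto intro!: sum.neutral)
      qed
    qed
    finally have eq: "(\<Sum>n\<le>M. \<Sum>l\<in>A. \<Sum>m\<in>A. if int n + l = m then b n * g l * h m else 0)
        = (\<Sum>l\<in>A. \<Sum>m\<in>A. if l \<le> m then b (nat (m - l)) * g l * h m else 0)" .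
    have "norm (\<Sum>n\<le>M. b n * w ^ n) \<le> S + ?tail M" if w: "norm w = 1" for w
    proof -
      have nw: "norm (b n * w ^ n) = norm (b n)" for n
        by (simp add: norm_mult norm_power w)
      have sm: "summable (\<lambda>n. norm (b n * w ^ n))"
        unfolding nw by (rule b)
      have split: "(\<Sum>n. b n * w ^ n) = (\<Sum>n. b (n + Suc M) * w ^ (n + Suc M)) + (\<Sum>n\<le>M. b n * w ^ n)"
        using suminf_split_initial_segment[OF summable_norm_cancel[OF sm], of "Suc M"]
        by (simp only: lessThan_Suc_atMost)
      have "norm (\<Sum>n. b (n + Suc M) * w ^ (n + Suc M)) \<le> (\<Sum>n. norm (b (n + Suc M) * w ^ (n + Suc M)))"
        using summable_ignore_initial_segment[OF sm, of "Suc M"] by (rule summable_norm)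
      then have "norm (\<Sum>n. b (n + Suc M) * w ^ (n + Suc M)) \<le> ?tail M"
        unfolding nw .
      moreover have "(\<Sum>n\<le>M. b n * w ^ n) = (\<Sum>n. b n * w ^ n) - (\<Sum>n. b (n + Suc M) * w ^ (n + Suc M))"
        using split by simp
      then have "norm (\<Sum>n\<le>M. b n * w ^ n)
          \<le> norm (\<Sum>n. b n * w ^ n) + norm (\<Sum>n. b (n + Suc M) * w ^ (n + Suc M))"
        by (simp only: norm_triangle_ineq4)
      ultimately show ?thesis
        using S[OF w] by linarith
    qed
    then show ?thesis
      unfolding eq[symmetric] by (rule toeplitz_form_le_finite[OF A])
  qed
  then show "\<exists>N. \<forall>M\<ge>N. norm (\<Sum>l\<in>A. \<Sum>m\<in>A. if l \<le> m then b (nat (m - l)) * g l * h m else 0)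
      \<le> (S + ?tail M) * ?g * ?h"
    by blast
qed

subsection \<open>The multiplier bound\<close>

text \<open>Euler's integral after substituting \<open>c * y\<close> for its variable.\<close>

lemma Gamma_integral_scaled:
  fixes s c :: real
  assumes "s > 0" "c > 0"
  shows "((\<lambda>y. y powr (s - 1) * exp (- (c * y))) has_integral Gamma s / c powr s) {0..}"
proof -
  define f where "f = (\<lambda>t::real. t powr (s - 1) / exp t)"
  have f: "(f has_integral Gamma s) {0..}"
    unfolding f_def by (rule Gamma_integral_real[OF assms(1)])
  then have "f absolutely_integrable_on {0..}"
    by (intro nonnegative_absolutely_integrable_1) (auto simp: f_def has_integral_integrable)
  moreover have img: "(\<lambda>x. c * x) ` {0..} = {0..}"
  proof (intro subset_antisym subsetI)
    fix x :: real assume "x \<in> {0..}"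
    then show "x \<in> (\<lambda>x. c * x) ` {0..}"
      using assms by (intro image_eqI[of _ _ "x / c"]) auto
  qed (use assms in auto)
  ultimately have "f absolutely_integrable_on (\<lambda>x. c * x) ` {0..} \<and> integral ((\<lambda>x. c * x) ` {0..}) f = Gamma s"
    using f by (simp add: integral_unique)
  then have "(\<lambda>x. \<bar>c\<bar> * f (c * x)) absolutely_integrable_on {0..} \<and> integral {0..} (\<lambda>x. \<bar>c\<bar> * f (c * x)) = Gamma s"
    by (subst has_absolute_integral_change_of_variables_1')
      (use assms in \<open>auto intro!: derivative_eq_intros simp: inj_on_def\<close>)
  then have "((\<lambda>x. c * f (c * x)) has_integral Gamma s) {0..}"
    using assms by (auto simp: has_integral_iff set_lebesgue_integral_eq_integral(1))
  then have "((\<lambda>x. c * f (c * x) / c powr s) has_integral Gamma s / c powr s) {0..}"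
    by (rule has_integral_divide)
  then show ?thesis
  proof (rule has_integral_eq[rotated])
    fix x :: real assume "x \<in> {0..}"
    then have "(c * x) powr (s - 1) = c powr (s - 1) * x powr (s - 1)"
      using assms by (simp add: powr_mult)
    moreover have "c * c powr (s - 1) = c powr s"
      using assms by (simp add: powr_diff)
    ultimately show "c * f (c * x) / c powr s = x powr (s - 1) * exp (- (c * x))"
      using assms by (simp add: f_def exp_minus field_simps)
  qed
qed

section \<open>The exponentially damped series on the unit circle\<close>

lemma norm_qprod_diagonal_minus_1_le:
  assumes "norm w \<le> 1 / 2"
  shows "norm (qprod w w - 1) \<le> 4 * norm w"
proof (rule LIMSEQ_le_const2)
  show "(\<lambda>n. norm ((\<Prod>k<n. 1 - w * w ^ k) - 1)) \<longlonglongrightarrow> norm (qprod w w - 1)"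
    using assms by (intro tendsto_intros LIMSEQ_qprod) auto
  have "norm ((\<Prod>k<n. 1 - w * w ^ k) - 1) \<le> 4 * norm w" for n
  proof -
    have "norm ((\<Prod>k<n. 1 + (- (w * w ^ k))) - 1) \<le> (\<Prod>k<n. 1 + norm (- (w * w ^ k))) - 1"
      by (rule norm_prod_minus1_le_prod_minus1)
    also have "(\<Prod>k<n. 1 + norm (- (w * w ^ k))) \<le> exp (\<Sum>k<n. norm (- (w * w ^ k)))"
      by (rule prod_le_exp_sum) auto
    also have "(\<Sum>k<n. norm (- (w * w ^ k))) = norm w * (\<Sum>k<n. norm w ^ k)"
      by (simp add: norm_mult norm_power sum_distrib_left)
    also have "(\<Sum>k<n. norm w ^ k) \<le> (\<Sum>k. norm w ^ k)"
      using assms by (intro sum_le_suminf summable_geometric) auto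
    also have "(\<Sum>k. norm w ^ k) = 1 / (1 - norm w)"
      using assms by (intro suminf_geometric) auto
    also have "1 / (1 - norm w) \<le> 2"
      using assms by (simp add: field_simps)
    \<comment> \<open>Since \<open>2 * norm w \<le> 1\<close>, the quadratic term is at most
      \<open>2 * norm w\<close>, whence the constant 4.\<close>
    also have "exp (norm w * 2) \<le> 1 + 2 * norm w + (2 * norm w)\<^sup>2"
      using exp_bound[of "2 * norm w"] assms by (simp add: mult.commute)
    also have "(2 * norm w)\<^sup>2 \<le> 2 * norm w * 1"
      unfolding power2_eq_square using assms by (intro mult_left_mono) auto
    finally show ?thesis
      by (simp add: mult_left_mono)
  qed
  then show "\<exists>N. \<forall>n\<ge>N. norm ((\<Prod>k<n. 1 - w * w ^ k) - 1) \<le> 4 * norm w"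
    by blast
qed

lemma euler_coeff_0: "euler_coeff 0 = 1"
proof -
  have "(\<lambda>n. of_int (euler_coeff n) * (0::complex) ^ n) sums of_int (euler_coeff 0)"
    using powser_sums_zero[of "\<lambda>n. of_int (euler_coeff n) :: complex"] by simp
  from sums_unique2[OF this euler_coeff_sums[of 0]] have "of_int (euler_coeff 0) = qprod 0 0"
    by simp
  also have "qprod 0 0 = 1"
    by (simp add: qprod_def)
  finally show ?thesis
    by simp
qed

text \<open>The coefficients in \<open>w\<close> of \<open>qprod z z - 1\<close> for
  \<open>z = exp (- y) * w\<close>. Removing the constant term matches the sum in
  \<open>I_sf\<close> and makes the series decay as \<open>y\<close> grows.\<close>

definition damped_coeff :: "real \<Rightarrow> nat \<Rightarrow> complex" where
  "damped_coeff y n = (if n = 0 then 0 else of_int (euler_coeff n) * of_real (exp (- (real n * y))))"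

lemma damped_coeff_mult_power:
  "damped_coeff y n * w ^ n
    = of_int (euler_coeff n) * (of_real (exp (- y)) * w) ^ n - (if n = 0 then 1 else 0)"
proof -
  have "exp (- (real n * y)) = exp (- y) ^ n"
    using exp_of_nat_mult[of n "- y"] by simp
  then show ?thesis
    by (simp add: damped_coeff_def euler_coeff_0 power_mult_distrib)
qed

text \<open>The power series converges at \<open>exp (- (y / 2))\<close>, hence absolutely at the
  smaller radius \<open>exp (- y)\<close>.\<close>

lemma summable_norm_damped_coeff:
  assumes "y > 0"
  shows "summable (\<lambda>n. norm (damped_coeff y n))"
proof -
  have "summable (\<lambda>n. of_int (euler_coeff n) * complex_of_real (exp (- (y / 2))) ^ n)"
    using assms by (intro sums_summable[OF euler_coeff_sums]) auto
  then have "summable (\<lambda>n. norm (of_int (euler_coeff n) * complex_of_real (exp (- y)) ^ n))"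
    by (rule powser_insidea) (use assms in auto)
  then show ?thesis
    by (rule summable_comparison_test_ev[rotated])
      (auto intro!: always_eventually simp: damped_coeff_def norm_mult norm_power simp flip: exp_of_nat_mult)
qed

text \<open>A single majorant for all \<open>y > 0\<close>, integrable against
  \<open>y powr (s - 1)\<close> when \<open>s > 1 / 4\<close>. For \<open>y \<le> 1\<close> it comes
  from the eta bound, for larger \<open>y\<close> from the linear bound near
  \<open>w = 0\<close>.\<close>

lemma norm_damped_series_le:
  assumes y: "y > 0" and w: "norm w = 1"
  shows "norm (\<Sum>n. damped_coeff y n * w ^ n)
    \<le> (((8 * exp 5) powr (1 / 4) + 1) * exp 1 + 8) * (y powr (- 1 / 4) * exp (- (y / 2)))"
proof -
  define K where "K = (8 * exp 5 :: real) powr (1 / 4)"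
  have K: "K \<ge> 0"
    by (simp add: K_def)
  define z where "z = of_real (exp (- y)) * w"
  have z: "norm z = exp (- y)"
    by (simp add: z_def norm_mult w)
  have "(\<lambda>n. of_int (euler_coeff n) * z ^ n - (if n = 0 then 1 else 0)) sums (qprod z z - 1)"
    using y z by (intro sums_diff euler_coeff_sums sums_single) auto
  then have eq: "(\<Sum>n. damped_coeff y n * w ^ n) = qprod z z - 1"
    unfolding damped_coeff_mult_power z_def[symmetric] by (rule sums_unique[symmetric])
  have "norm (qprod z z - 1) \<le> ((K + 1) * exp 1 + 8) * (y powr (- 1 / 4) * exp (- (y / 2)))"
  proof (cases "y \<le> 1")
    case True
    have "norm (qprod z z) \<le> K * y powr (- 1 / 4)"
      unfolding K_def using norm_qprod_diagonal_le[OF z y True] .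
    moreover have one: "1 \<le> y powr (- 1 / 4)"
      using y True powr_mono_both'[of "- (1 / 4)" 0 y 1] by (simp add: powr_le_one_le powr_minus_divide powr_le1)
    ultimately have "norm (qprod z z - 1) \<le> (K + 1) * y powr (- 1 / 4)"
      using norm_triangle_ineq4[of "qprod z z" 1] by (simp add: algebra_simps)
    also have "\<dots> = (K + 1) * y powr (- 1 / 4) * 1"
      by simp
    \<comment> \<open>For \<open>y \<le> 1\<close> the inserted exponential is at least 1.\<close>
    also have "\<dots> \<le> (K + 1) * y powr (- 1 / 4) * exp (1 - y / 2)"
      using K True by (intro mult_left_mono) auto
    also have "exp (1 - y / 2) = exp 1 * exp (- (y / 2))"
      by (simp flip: exp_add)
    also have "(K + 1) * y powr (- 1 / 4) * (exp 1 * exp (- (y / 2)))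
        = (K + 1) * exp 1 * (y powr (- 1 / 4) * exp (- (y / 2)))"
      by (simp only: mult_ac)
    also have "\<dots> \<le> ((K + 1) * exp 1 + 8) * (y powr (- 1 / 4) * exp (- (y / 2)))"
      by (intro mult_right_mono) auto
    finally show ?thesis .
  next
    case False
    have "exp (- y) \<le> exp (- 1 :: real)"
      using False by simp
    also have "exp (- 1 :: real) \<le> 1 / 2"
      using exp_ge_add_one_self[of "1 :: real"] by (simp add: exp_minus field_simps)
    finally have "norm (qprod z z - 1) \<le> 4 * exp (- y)"
      using norm_qprod_diagonal_minus_1_le[of z] by (simp add: z)
    \<comment> \<open>One half of the decay is kept; the other absorbs the power through
      \<open>y powr (1 / 4) \<le> y \<le> 2 * exp (y / 2)\<close>.\<close>
    also have "exp (- y) = exp (- (y / 2)) * exp (- (y / 2))"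
      by (simp add: exp_add[symmetric])
    also have "4 * (exp (- (y / 2)) * exp (- (y / 2))) \<le> 4 * (2 * y powr (- 1 / 4) * exp (- (y / 2)))"
    proof (intro mult_left_mono mult_right_mono)
      have "y powr (1 / 4) \<le> y powr 1"
        using False by (intro powr_mono) auto
      also have "\<dots> \<le> 2 * exp (y / 2)"
        using order_trans[OF _ exp_ge_add_one_self, of "y / 2" "y / 2"] y by simp
      finally show "exp (- (y / 2)) \<le> 2 * y powr (- 1 / 4)"
        using y by (simp add: exp_minus powr_minus field_simps)
    qed auto
    also have "\<dots> = 8 * (y powr (- 1 / 4) * exp (- (y / 2)))"
      by simp
    also have "\<dots> \<le> ((K + 1) * exp 1 + 8) * (y powr (- 1 / 4) * exp (- (y / 2)))"
      using K by (intro mult_right_mono) auto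
    finally show ?thesis .
  qed
  then show ?thesis
    unfolding eq K_def .
qed

text \<open>At \<open>n = 0\<close> the conventions \<open>0 powr s = 0\<close> and
  \<open>x / 0 = 0\<close> give the value 0, so sums may start at 0.\<close>

definition frac_kernel :: "real \<Rightarrow> nat \<Rightarrow> complex" where
  "frac_kernel s n = of_real (real_of_int (euler_coeff n) / real n powr s)"

lemma frac_kernel_0 [simp]: "frac_kernel s 0 = 0"
  by (simp add: frac_kernel_def)

lemma frac_kernel_integral:
  assumes "s > 0"
  shows "((\<lambda>y. (y powr (s - 1)) *\<^sub>R damped_coeff y n) has_integral Gamma s *\<^sub>R frac_kernel s n) {0..}"
proof (cases "n = 0")
  case True
  then show ?thesis
    by (simp add: damped_coeff_def)
next
  case False
  then have int: "((\<lambda>y. (y powr (s - 1) * exp (- (real n * y))) *\<^sub>R of_int (euler_coeff n))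
      has_integral (Gamma s / real n powr s) *\<^sub>R (of_int (euler_coeff n) :: complex)) {0..}"
    by (intro has_integral_scaleR_left[OF Gamma_integral_scaled[OF assms]]) simp
  have "(y powr (s - 1) * exp (- (real n * y))) *\<^sub>R of_int (euler_coeff n)
      = (y powr (s - 1)) *\<^sub>R damped_coeff y n" for y
    using False by (simp only: damped_coeff_def if_False scaleR_conv_of_real of_real_mult mult_ac)
  moreover have "(Gamma s / real n powr s) *\<^sub>R (of_int (euler_coeff n) :: complex)
      = Gamma s *\<^sub>R frac_kernel s n"
    by (simp add: frac_kernel_def scaleR_conv_of_real)
  ultimately show ?thesis
    using int by (simp only:)
qed

text \<open>The form is linear in its kernel, so \<open>Gamma s\<close> times it is the integral of
  the damped forms against \<open>y powr (s - 1)\<close>, and each damped form is bounded by the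
  supremum of its symbol.\<close>

lemma frac_kernel_form_le:
  assumes s: "s > 1 / 4"
  obtains C where "C \<ge> 0"
    "\<And>A g h. finite A \<Longrightarrow> norm (\<Sum>l\<in>A. \<Sum>m\<in>A. if l \<le> m then frac_kernel s (nat (m - l)) * g l * h m else 0)
      \<le> C * L2_set (\<lambda>l. norm (g l)) A * L2_set (\<lambda>m. norm (h m)) A"
proof
  define K :: real where "K = ((8 * exp 5) powr (1 / 4) + 1) * exp 1 + 8"
  have K: "K \<ge> 0"
    by (simp add: K_def)
  \<comment> \<open>The integral of \<open>y powr (s - 1 / 4 - 1) * exp (- (y / 2))\<close>; its
    convergence is where \<open>s > 1 / 4\<close> enters.\<close>
  define J where "J = Gamma (s - 1 / 4) / (1 / 2) powr (s - 1 / 4)"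
  have J: "J \<ge> 0"
    using s by (simp add: J_def Gamma_real_pos less_imp_le)
  have \<Gamma>: "Gamma s > 0"
    using s by (simp add: Gamma_real_pos)
  show "K * J / Gamma s \<ge> 0"
    using K J \<Gamma> by simp
  fix A :: "int set" and g h :: "int \<Rightarrow> complex"
  assume A: "finite A"
  define B where "B = (\<Sum>l\<in>A. \<Sum>m\<in>A. if l \<le> m then frac_kernel s (nat (m - l)) * g l * h m else 0)"
  define F where "F = (\<lambda>y. \<Sum>l\<in>A. \<Sum>m\<in>A. if l \<le> m then damped_coeff y (nat (m - l)) * g l * h m else 0)"
  define P where "P = L2_set (\<lambda>l. norm (g l)) A * L2_set (\<lambda>m. norm (h m)) A"
  have "((\<lambda>y. \<Sum>l\<in>A. \<Sum>m\<in>A. (y powr (s - 1)) *\<^sub>R (if l \<le> m then damped_coeff y (nat (m - l)) * g l * h m else 0))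
      has_integral (\<Sum>l\<in>A. \<Sum>m\<in>A. Gamma s *\<^sub>R (if l \<le> m then frac_kernel s (nat (m - l)) * g l * h m else 0))) {0..}"
  proof (intro has_integral_sum A)
    fix l m
    have "((\<lambda>y. (y powr (s - 1)) *\<^sub>R damped_coeff y n * (g l * h m))
        has_integral Gamma s *\<^sub>R frac_kernel s n * (g l * h m)) {0..}" for n
      using s by (intro has_integral_mult_left frac_kernel_integral) auto
    then show "((\<lambda>y. (y powr (s - 1)) *\<^sub>R (if l \<le> m then damped_coeff y (nat (m - l)) * g l * h m else 0))
        has_integral Gamma s *\<^sub>R (if l \<le> m then frac_kernel s (nat (m - l)) * g l * h m else 0)) {0..}"
      by (cases "l \<le> m") (simp_all add: mult.assoc)
  qed
  then have int: "((\<lambda>y. (y powr (s - 1)) *\<^sub>R F y) has_integral Gamma s *\<^sub>R B) {0..}"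
    unfolding F_def B_def scaleR_sum_right .
  have "((\<lambda>y. K * P * (y powr (s - 1 / 4 - 1) * exp (- (1 / 2 * y)))) has_integral K * P * J) {0..}"
    unfolding J_def using s by (intro has_integral_mult_right Gamma_integral_scaled) auto
  then have intb: "((\<lambda>y. K * P * (y powr (s - 1 / 4 - 1) * exp (- (y / 2)))) has_integral K * P * J) {0..}"
    by simp
  have "norm (integral {0..} (\<lambda>y. (y powr (s - 1)) *\<^sub>R F y))
      \<le> integral {0..} (\<lambda>y. K * P * (y powr (s - 1 / 4 - 1) * exp (- (y / 2))))"
  proof (rule integral_norm_bound_integral)
    fix y :: real assume "y \<in> {0..}"
    show "norm ((y powr (s - 1)) *\<^sub>R F y) \<le> K * P * (y powr (s - 1 / 4 - 1) * exp (- (y / 2)))"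
    \<comment> \<open>At \<open>y = 0\<close> both sides vanish, as 0 to any power is 0 for
      \<open>powr\<close>.\<close>
    proof (cases "y = 0")
      case False
      with \<open>y \<in> {0..}\<close> have y: "y > 0"
        by simp
      have "norm (F y) \<le> K * (y powr (- 1 / 4) * exp (- (y / 2)))
          * L2_set (\<lambda>l. norm (g l)) A * L2_set (\<lambda>m. norm (h m)) A"
        unfolding F_def
      proof (rule toeplitz_form_le[OF A summable_norm_damped_coeff[OF y]])
        show "norm (\<Sum>n. damped_coeff y n * w ^ n) \<le> K * (y powr (- 1 / 4) * exp (- (y / 2)))"
          if "norm w = 1" for w
          unfolding K_def using norm_damped_series_le[OF y that] .
      qed
      also have "\<dots> = K * P * (y powr (- 1 / 4) * exp (- (y / 2)))"
        by (simp add: P_def)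
      finally have "y powr (s - 1) * norm (F y) \<le> y powr (s - 1) * (K * P * (y powr (- 1 / 4) * exp (- (y / 2))))"
        by (intro mult_left_mono) auto
      also have "\<dots> = K * P * ((y powr (s - 1) * y powr (- 1 / 4)) * exp (- (y / 2)))"
        by simp
      also have "y powr (s - 1) * y powr (- 1 / 4) = y powr (s - 1 / 4 - 1)"
        by (simp add: powr_add[symmetric] algebra_simps)
      finally show ?thesis
        by simp
    qed auto
  qed (use int intb in \<open>auto simp: has_integral_integrable\<close>)
  then have "Gamma s * norm B \<le> K * P * J"
    unfolding integral_unique[OF int] integral_unique[OF intb] using \<Gamma> by simp
  then have "norm B \<le> K * J / Gamma s * P"
    using \<Gamma> by (simp add: field_simps)
  then show "norm B \<le> K * J / Gamma s * L2_set (\<lambda>l. norm (g l)) A * L2_set (\<lambda>m. norm (h m)) A"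
    by (simp add: P_def mult.assoc)
qed

section \<open>From the bilinear form to the operator on square-summable functions\<close>

text \<open>Duality: testing the form with the conjugate of the output \<open>u\<close>, restricted
  to \<open>W\<close>, gives \<open>X \<le> C * L2_set (\<lambda>l. norm (g l)) A * sqrt X\<close>,
  and one factor \<open>sqrt X\<close> divides out.\<close>

lemma l2_window_le:
  fixes g :: "int \<Rightarrow> complex"
  assumes C: "C \<ge> 0"
    "\<And>g h. norm (\<Sum>l\<in>A. \<Sum>m\<in>A. if l \<le> m then k (nat (m - l)) * g l * h m else 0)
      \<le> C * L2_set (\<lambda>l. norm (g l)) A * L2_set (\<lambda>m. norm (h m)) A"
    and A: "finite A" "W \<subseteq> A"
  shows "(\<Sum>m\<in>W. norm (\<Sum>l\<in>A. if l \<le> m then k (nat (m - l)) * g l else 0) ^ 2)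
    \<le> C\<^sup>2 * (\<Sum>l\<in>A. norm (g l) ^ 2)"
proof -
  define u where "u = (\<lambda>m. \<Sum>l\<in>A. if l \<le> m then k (nat (m - l)) * g l else 0)"
  define h where "h = (\<lambda>m. if m \<in> W then cnj (u m) else 0)"
  define X where "X = (\<Sum>m\<in>W. norm (u m) ^ 2)"
  have X: "X \<ge> 0"
    unfolding X_def by (intro sum_nonneg) auto
  have "(\<Sum>l\<in>A. \<Sum>m\<in>A. if l \<le> m then k (nat (m - l)) * g l * h m else 0)
      = (\<Sum>m\<in>A. \<Sum>l\<in>A. if l \<le> m then k (nat (m - l)) * g l * h m else 0)"
    by (rule sum.swap)
  also have "\<dots> = (\<Sum>m\<in>A. u m * h m)"
    unfolding u_def sum_distrib_right by (intro sum.cong refl) auto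
  also have "\<dots> = (\<Sum>m\<in>W. u m * cnj (u m))"
    using A by (intro sum.mono_neutral_cong_right) (auto simp: h_def)
  also have "\<dots> = of_real X"
    unfolding X_def of_real_sum complex_norm_square ..
  finally have form: "norm (\<Sum>l\<in>A. \<Sum>m\<in>A. if l \<le> m then k (nat (m - l)) * g l * h m else 0) = X"
    using X by simp
  have "(\<Sum>m\<in>A. norm (h m) ^ 2) = X"
    unfolding X_def using A by (intro sum.mono_neutral_cong_right) (auto simp: h_def)
  then have h: "L2_set (\<lambda>m. norm (h m)) A = sqrt X"
    by (simp add: L2_set_def)
  have "sqrt X * sqrt X \<le> C * L2_set (\<lambda>l. norm (g l)) A * sqrt X"
    using C(2)[of g h] X unfolding form h by simp
  then have "sqrt X \<le> C * L2_set (\<lambda>l. norm (g l)) A"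
  proof (cases "X = 0")
    case False
    then have "sqrt X > 0"
      using X by simp
    then show ?thesis
      using \<open>sqrt X * sqrt X \<le> _\<close> mult_right_le_imp_le by blast
  qed (use C(1) in auto)
  then have "sqrt X ^ 2 \<le> (C * L2_set (\<lambda>l. norm (g l)) A) ^ 2"
    using X by (intro power_mono) auto
  then show ?thesis
    using X by (simp add: X_def u_def power_mult_distrib L2_set_def sum_nonneg)
qed

text \<open>The window bound passes to the limit of growing windows. This requires the series of
  \<open>I_sf\<close> to converge, which holds because both the kernel and \<open>g\<close> are
  square summable. Bounds on all finite sums express membership in the space together with its
  norm.\<close>

lemma I_sf_l2_bounded:
  assumes s: "s > 1 / 4"
  obtains C where "C \<ge> 0"
    "\<And>g N F. (\<And>F. finite F \<Longrightarrow> (\<Sum>m\<in>F. norm (g m) ^ 2) \<le> N\<^sup>2) \<Longrightarrow> finite F \<Longrightarrow>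
      (\<Sum>m\<in>F. norm (I_sf s g m) ^ 2) \<le> (C * N)\<^sup>2"
proof -
  obtain C where C: "C \<ge> 0"
    "\<And>A g h. finite A \<Longrightarrow> norm (\<Sum>l\<in>A. \<Sum>m\<in>A. if l \<le> m then frac_kernel s (nat (m - l)) * g l * h m else 0)
      \<le> C * L2_set (\<lambda>l. norm (g l)) A * L2_set (\<lambda>m. norm (h m)) A"
    using frac_kernel_form_le[OF s] by blast
  note window = l2_window_le[OF C(1) C(2)]
  have "summable (\<lambda>n. norm (frac_kernel s n) ^ 2)"
  proof (rule summableI_nonneg_bounded)
    fix M
    define A where "A = {0..int M}"
    \<comment> \<open>The response to a unit impulse is the kernel itself, so the window bound shows
      that the kernel is square summable.\<close>
    define \<delta> :: "int \<Rightarrow> complex" where "\<delta> = (\<lambda>l. if l = 0 then 1 else 0)"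
    have A: "finite A" "0 \<in> A"
      by (auto simp: A_def)
    have "(\<Sum>l\<in>A. if l \<le> m then frac_kernel s (nat (m - l)) * \<delta> l else 0) = frac_kernel s (nat m)"
      if "m \<in> A" for m
    proof -
      have "(\<Sum>l\<in>A. if l \<le> m then frac_kernel s (nat (m - l)) * \<delta> l else 0)
          = (\<Sum>l\<in>A. if l = 0 then frac_kernel s (nat m) else 0)"
        using that by (intro sum.cong) (auto simp: \<delta>_def A_def)
      then show ?thesis
        using A by simp
    qed
    then have "(\<Sum>m\<in>A. norm (frac_kernel s (nat m)) ^ 2)
        = (\<Sum>m\<in>A. norm (\<Sum>l\<in>A. if l \<le> m then frac_kernel s (nat (m - l)) * \<delta> l else 0) ^ 2)"
      by simp
    also have "\<dots> \<le> C\<^sup>2 * (\<Sum>l\<in>A. norm (\<delta> l) ^ 2)"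
      using A by (intro window) auto
    also have "(\<Sum>l\<in>A. norm (\<delta> l) ^ 2) = (\<Sum>l\<in>A. if l = 0 then 1 else 0)"
      by (intro sum.cong) (auto simp: \<delta>_def)
    also have "\<dots> = 1"
      using A by simp
    finally have "(\<Sum>m\<in>A. norm (frac_kernel s (nat m)) ^ 2) \<le> C\<^sup>2"
      by simp
    moreover have "(\<Sum>n<M. norm (frac_kernel s n) ^ 2) = (\<Sum>m\<in>int ` {..<M}. norm (frac_kernel s (nat m)) ^ 2)"
      by (subst sum.reindex) auto
    moreover have "\<dots> \<le> (\<Sum>m\<in>A. norm (frac_kernel s (nat m)) ^ 2)"
      by (intro sum_mono2) (auto simp: A_def)
    ultimately show "(\<Sum>n<M. norm (frac_kernel s n) ^ 2) \<le> C\<^sup>2"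
      by simp
  qed auto
  note kernel = this
  have "(\<Sum>m\<in>F. norm (I_sf s g m) ^ 2) \<le> (C * N)\<^sup>2"
    if g: "\<And>F. finite F \<Longrightarrow> (\<Sum>m\<in>F. norm (g m) ^ 2) \<le> N\<^sup>2" and F: "finite F" for g N F
  proof -
    \<comment> \<open>The operator applied to \<open>g\<close> cut off outside
      \<open>-int L..int L\<close>.\<close>
    define u where "u = (\<lambda>L m. \<Sum>l=-int L..int L. if l \<le> m then frac_kernel s (nat (m - l)) * g l else 0)"
    have lim: "(\<lambda>L. u L m) \<longlonglongrightarrow> I_sf s g m" for m
    proof -
      have "summable (\<lambda>n. norm (g (m - int n)) ^ 2)"
      proof (rule summableI_nonneg_bounded)
        fix M
        have "(\<Sum>n<M. norm (g (m - int n)) ^ 2) = (\<Sum>j\<in>(\<lambda>n. m - int n) ` {..<M}. norm (g j) ^ 2)"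
          by (subst sum.reindex) (auto simp: inj_on_def)
        also have "\<dots> \<le> N\<^sup>2"
          by (intro g) auto
        finally show "(\<Sum>n<M. norm (g (m - int n)) ^ 2) \<le> N\<^sup>2" .
      qed auto
      from summable_add[OF kernel this]
      have "summable (\<lambda>n. norm (frac_kernel s n) ^ 2 + norm (g (m - int n)) ^ 2)" .
      then have sm: "summable (\<lambda>n. frac_kernel s n * g (m - int n))"
      proof (rule summable_comparison_test'[where N = 0])
        fix n
        have "2 * (norm (frac_kernel s n) * norm (g (m - int n)))
            \<le> norm (frac_kernel s n) ^ 2 + norm (g (m - int n)) ^ 2"
          using sum_squares_bound[of "norm (frac_kernel s n)" "norm (g (m - int n))"] by simp
        moreover have "0 \<le> norm (frac_kernel s n) * norm (g (m - int n))"
          by simp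
        ultimately show "norm (frac_kernel s n * g (m - int n))
            \<le> norm (frac_kernel s n) ^ 2 + norm (g (m - int n)) ^ 2"
          unfolding norm_mult by linarith
      qed
      have "I_sf s g m = (\<Sum>n. frac_kernel s (Suc n) * g (m - int (Suc n)))"
        by (simp add: I_sf_def frac_kernel_def)
      also have "\<dots> = (\<Sum>n. frac_kernel s n * g (m - int n))"
        using suminf_split_head[OF sm] by simp
      finally have "(\<lambda>M. \<Sum>n<M. frac_kernel s n * g (m - int n)) \<longlonglongrightarrow> I_sf s g m"
        using summable_LIMSEQ[OF sm] by simp
      moreover have "filterlim (\<lambda>L. Suc (nat (m + int L))) at_top sequentially"
        unfolding filterlim_at_top
      proof
        fix Z
        show "eventually (\<lambda>L. Z \<le> Suc (nat (m + int L))) sequentially"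
          by (rule eventually_sequentiallyI[of "Z + nat \<bar>m\<bar>"]) auto
      qed
      ultimately have "(\<lambda>L. \<Sum>n<Suc (nat (m + int L)). frac_kernel s n * g (m - int n)) \<longlonglongrightarrow> I_sf s g m"
        by (rule filterlim_compose)
      \<comment> \<open>For \<open>L \<ge> \<bar>m\<bar>\<close> the substitution
        \<open>l = m - int n\<close> takes \<open>n\<close> from 0 to \<open>m + int L\<close>
        inclusive, hence the \<open>Suc\<close>, onto \<open>l\<close> from \<open>-int L\<close> to
        \<open>m\<close>.\<close>
      moreover have "eventually (\<lambda>L. (\<Sum>n<Suc (nat (m + int L)). frac_kernel s n * g (m - int n)) = u L m) sequentially"
      proof (rule eventually_sequentiallyI[of "nat \<bar>m\<bar>"])
        fix L assume L: "nat \<bar>m\<bar> \<le> L"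
        have "u L m = (\<Sum>l=-int L..m. frac_kernel s (nat (m - l)) * g l)"
          unfolding u_def using L by (intro sum.mono_neutral_cong_right) auto
        also have "\<dots> = (\<Sum>n<Suc (nat (m + int L)). frac_kernel s n * g (m - int n))"
          using L by (intro sum.reindex_bij_witness[of _ "\<lambda>n. m - int n" "\<lambda>l. nat (m - l)"]) auto
        finally show "(\<Sum>n<Suc (nat (m + int L)). frac_kernel s n * g (m - int n)) = u L m" ..
      qed
      ultimately show ?thesis
        by (rule Lim_transform_eventually)
    qed
    have "(\<lambda>L. \<Sum>m\<in>F. norm (u L m) ^ 2) \<longlonglongrightarrow> (\<Sum>m\<in>F. norm (I_sf s g m) ^ 2)"
      by (intro tendsto_intros lim)
    then show ?thesis
    proof (rule LIMSEQ_le_const2)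
      have "(\<Sum>m\<in>F. norm (u L m) ^ 2) \<le> (C * N)\<^sup>2" if L: "L \<ge> nat (\<Sum>m\<in>F. \<bar>m\<bar>)" for L
      proof -
        have "F \<subseteq> {-int L..int L}"
        proof
          fix m assume "m \<in> F"
          then have "\<bar>m\<bar> \<le> (\<Sum>m\<in>F. \<bar>m\<bar>)"
            using F by (intro member_le_sum) auto
          with L show "m \<in> {-int L..int L}"
            by auto
        qed
        then have "(\<Sum>m\<in>F. norm (u L m) ^ 2) \<le> C\<^sup>2 * (\<Sum>l=-int L..int L. norm (g l) ^ 2)"
          unfolding u_def by (intro window) auto
        also have "\<dots> \<le> C\<^sup>2 * N\<^sup>2"
          by (intro mult_left_mono g) auto
        finally show ?thesis
          by (simp add: power_mult_distrib)
      qed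
      then show "\<exists>L. \<forall>n\<ge>L. (\<Sum>m\<in>F. norm (u n m) ^ 2) \<le> (C * N)\<^sup>2"
        by blast
    qed
  qed
  with C(1) that show ?thesis
    by blast
qed

subsection \<open>Sequence spaces\<close>

lemma lp_norm_nonneg: "lp_norm p g \<ge> 0"
  by (simp add: lp_norm_def)

text \<open>Each value is at most the norm \<open>N\<close>, so of \<open>norm (g m) ^ 2\<close> the
  part \<open>norm (g m) powr (2 - p)\<close> can be replaced by
  \<open>N powr (2 - p)\<close>.\<close>

lemma l2_sum_le_lp_norm:
  assumes p: "0 < p" "p \<le> 2" and g: "in_lp p g" and F: "finite F"
  shows "(\<Sum>m\<in>F. norm (g m) ^ 2) \<le> (lp_norm p g)\<^sup>2"
proof -
  define N where "N = lp_norm p g"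
  have N: "N \<ge> 0"
    by (simp add: N_def lp_norm_nonneg)
  have Np: "N powr p = (\<Sum>\<^sub>\<infinity>m. norm (g m) powr p)"
    using p by (simp add: N_def lp_norm_def powr_powr infsum_nonneg)
  have sum_le: "(\<Sum>m\<in>F. norm (g m) powr p) \<le> N powr p" if "finite F" for F
    unfolding Np using g that by (intro finite_sum_le_infsum) (auto simp: in_lp_def)
  have le: "norm (g m) \<le> N" for m
  proof -
    have "norm (g m) powr p \<le> N powr p"
      using sum_le[of "{m}"] by simp
    then show ?thesis
      using p N powr_less_mono2[of p N "norm (g m)"] by linarith
  qed
  have "(\<Sum>m\<in>F. norm (g m) ^ 2) \<le> (\<Sum>m\<in>F. norm (g m) powr p * N powr (2 - p))"
  proof (rule sum_mono)
    fix m
    show "norm (g m) ^ 2 \<le> norm (g m) powr p * N powr (2 - p)"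
    proof (cases "g m = 0")
      case False
      then have "norm (g m) ^ 2 = norm (g m) powr p * norm (g m) powr (2 - p)"
        by (simp add: powr_add[symmetric])
      also have "\<dots> \<le> norm (g m) powr p * N powr (2 - p)"
        using p le by (intro mult_left_mono powr_mono2) auto
      finally show ?thesis .
    qed auto
  qed
  also have "\<dots> \<le> N powr p * N powr (2 - p)"
    unfolding sum_distrib_right[symmetric] by (intro mult_right_mono sum_le F) auto
  also have "\<dots> = N\<^sup>2"
    using N by (cases "N = 0") (auto simp: powr_add[symmetric])
  finally show ?thesis
    by (simp add: N_def)
qed

text \<open>The same splitting in the other direction: each value is at most \<open>D\<close>, and
  the surplus power \<open>q - 2\<close> is bounded by \<open>D powr (q - 2)\<close>.\<close>

lemma lp_norm_le_l2_bound:
  assumes q: "q \<ge> 2" and D: "D \<ge> 0"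
    and f: "\<And>F. finite F \<Longrightarrow> (\<Sum>m\<in>F. norm (f m) ^ 2) \<le> D\<^sup>2"
  shows "in_lp q f" "lp_norm q f \<le> D"
proof -
  have le: "norm (f m) \<le> D" for m
    using f[of "{m}"] D by (simp add: power2_le_iff_abs_le)
  have sum_le: "(\<Sum>m\<in>F. norm (f m) powr q) \<le> D powr q" if "finite F" for F
  proof -
    have "(\<Sum>m\<in>F. norm (f m) powr q) \<le> (\<Sum>m\<in>F. norm (f m) ^ 2 * D powr (q - 2))"
    proof (rule sum_mono)
      fix m
      show "norm (f m) powr q \<le> norm (f m) ^ 2 * D powr (q - 2)"
      proof (cases "f m = 0")
        case False
        then have "norm (f m) powr q = norm (f m) ^ 2 * norm (f m) powr (q - 2)"
          by (simp add: powr_diff)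
        also have "\<dots> \<le> norm (f m) ^ 2 * D powr (q - 2)"
          using q le by (intro mult_left_mono powr_mono2) auto
        finally show ?thesis .
      qed auto
    qed
    also have "\<dots> \<le> D\<^sup>2 * D powr (q - 2)"
      unfolding sum_distrib_right[symmetric] by (intro mult_right_mono f that) auto
    also have "\<dots> = D powr q"
      using D by (cases "D = 0") (auto simp: powr_diff)
    finally show ?thesis .
  qed
  have summable: "(\<lambda>m. norm (f m) powr q) summable_on UNIV"
    by (rule nonneg_bdd_above_summable_on) (auto intro!: bdd_aboveI2 sum_le)
  then show "in_lp q f"
    by (simp add: in_lp_def)
  have "(\<Sum>\<^sub>\<infinity>m. norm (f m) powr q) \<le> D powr q"
    using summable sum_le by (intro infsum_le_finite_sums) auto
  then have "lp_norm q f \<le> (D powr q) powr (1 / q)"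
    unfolding lp_norm_def using q by (intro powr_mono2) (auto intro: infsum_nonneg)
  then show "lp_norm q f \<le> D"
    using q D by (simp add: powr_powr)
qed

theorem theorem4:
  fixes s p q :: real
  assumes "1/4 < s" "s < 1/2"
    and "1 < p" "p \<le> 2" "2 \<le> q"
    and "1 / q \<le> 1 / p - 1/2 + s"
  shows "\<exists>C. \<forall>g. in_lp p g \<longrightarrow> in_lp q (I_sf s g) \<and> lp_norm q (I_sf s g) \<le> C * lp_norm p g"
proof -
  obtain C where C: "C \<ge> 0"
    "\<And>g N F. (\<And>F. finite F \<Longrightarrow> (\<Sum>m\<in>F. norm (g m) ^ 2) \<le> N\<^sup>2) \<Longrightarrow> finite F \<Longrightarrow>
      (\<Sum>m\<in>F. norm (I_sf s g m) ^ 2) \<le> (C * N)\<^sup>2"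
    using I_sf_l2_bounded[OF assms(1)] by blast
  have "in_lp q (I_sf s g) \<and> lp_norm q (I_sf s g) \<le> C * lp_norm p g" if g: "in_lp p g" for g
  proof -
    have "(\<Sum>m\<in>F. norm (g m) ^ 2) \<le> (lp_norm p g)\<^sup>2" if "finite F" for F
      using assms(3,4) g that by (intro l2_sum_le_lp_norm) auto
    note C(2)[OF this]
    moreover have "C * lp_norm p g \<ge> 0"
      using C(1) by (simp add: lp_norm_nonneg)
    ultimately show ?thesis
      using lp_norm_le_l2_bound[OF assms(5)] by blast
  qed
  then show ?thesis
    by blast
qed

end
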